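(* Let $d\ge 1$, $R,\rho>0$ and $r,s\in\mathbb{N}_0$ be given. Then there is a positive constant $C_2=C_2(d,R,\rho,r,s)$ (depending only on $d,R,\rho,r,s$) such that $$d_{bL}\big(\mathcal{V}_R^{r,s}(K;\cdot),\mathcal{V}_R^{r,s}(K_0;\cdot)\big)\le C_2\, d_H(K,K_0)^{1/2}$$ for all nonempty compact sets $K,K_0\subseteq B(0,\rho)\subseteq\mathbb{R}^d$.
   Context: $B(x,\rho)$ is the closed Euclidean ball in $\mathbb{R}^d$ with center $x$ and radius $\rho$. For a nonempty compact set $K\subseteq\mathbb{R}^d$, $d_K(x)$ is the Euclidean distance from $x$ to $K$, $K^R=\{x\in\mathbb{R}^d: d_K(x)\le R\}$, and $p_K(x)$ is the point of $K$ closest to $x$ whenever it is unique; $p_K$ is defined Lebesgue-almost everywhere on $\mathbb{R}^d$. The Hausdorff distance is $d_H(K,M)=\inf\{\varepsilon>0: K\subseteq M^\varepsilon, M\subseteq K^\varepsilon\}$. $\mathbb{T}^p$ is the space of symmetric tensors of rank $p$ over $\mathbb{R}^d$, viewed as symmetric $p$-linear maps $(\mathbb{R}^d)^p\to\mathbb{R}$ via the scalar product, with norm $|T|=\sup\{|T(v_1,\dots,v_p)|: |v_1|=\dots=|v_p|=1\}$. For $x,y\in\mathbb{R}^d$, $x^r$ is the $r$-fold tensor power and $x^ry^s\in\mathbb{T}^{r+s}$ is the symmetric tensor product, i.e. the symmetrization ($\frac{1}{(r+s)!}\sum$ over all permutations of the factors) of $x^{\otimes r}\otimes y^{\otimes s}$.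 The Voronoi tensor measure of a nonempty compact set $K$ is the $\mathbb{T}^{r+s}$-valued measure given on Borel sets $A\subseteq\mathbb{R}^d$ by $$\mathcal{V}_R^{r,s}(K;A)=\int_{K^R}\mathbf{1}_A(p_K(x))\,p_K(x)^r(x-p_K(x))^s\,dx.$$ For bounded $\mathbb{T}^p$-valued Borel measures $\mu,\nu$ on $\mathbb{R}^d$, $d_{bL}(\mu,\nu)=\sup\{|\int f\,d\mu-\int f\,d\nu|: |f|_{bL}\le 1\}$, the supremum over bounded Lipschitz functions $f:\mathbb{R}^d\to\mathbb{R}$, where $|f|_{bL}=|f|_L+|f|_\infty$, $|f|_\infty$ is the supremum norm and $|f|_L=\sup_{x\ne y}|f(x)-f(y)|/|x-y|$. *)

theory Defs
  imports "HOL-Analysis.Analysis" "HOL-Combinatorics.Permutations"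
begin

definition parallel_set :: "'a::euclidean_space set \<Rightarrow> real \<Rightarrow> 'a set" where
  "parallel_set K R = {x. infdist x K \<le> R}"

definition hausdorff_dist :: "'a::euclidean_space set \<Rightarrow> 'a set \<Rightarrow> real" where
  "hausdorff_dist K M = Inf {\<epsilon>. \<epsilon> > 0 \<and> K \<subseteq> parallel_set M \<epsilon> \<and> M \<subseteq> parallel_set K \<epsilon>}"

text \<open>
  A tensor of rank \<open>p\<close> is encoded as a multilinear map of the argument vectors
  \<open>v 0, \<dots>, v (p - 1)\<close>; only these \<open>p\<close> values of \<open>v\<close> are relevant. Vectors are tensors
  of rank 1 via the inner product.
\<close>

type_synonym 'a tensor = "(nat \<Rightarrow> 'a) \<Rightarrow> real"

definition tensor_norm :: "nat \<Rightarrow> ('a::euclidean_space) tensor \<Rightarrow> real" where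
  "tensor_norm p T = (SUP v\<in>{v. \<forall>i<p. norm (v i) = 1}. \<bar>T v\<bar>)"

definition tensor_power :: "'a::euclidean_space \<Rightarrow> nat \<Rightarrow> 'a tensor" where
  "tensor_power x r = (\<lambda>v. \<Prod>i<r. x \<bullet> v i)"

text \<open>The tensor product of \<open>S\<close> of rank \<open>r\<close> with \<open>T\<close>.\<close>

definition tensor_prod :: "nat \<Rightarrow> ('a::euclidean_space) tensor \<Rightarrow> 'a tensor \<Rightarrow> 'a tensor" where
  "tensor_prod r S T = (\<lambda>v. S v * T (\<lambda>i. v (r + i)))"

text \<open>
  Permuting the factors of a tensor amounts to permuting its arguments by the inverse
  permutation, which is immaterial in a sum over all permutations.
\<close>

definition symmetrization :: "nat \<Rightarrow> ('a::euclidean_space) tensor \<Rightarrow> 'a tensor" where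
  "symmetrization p T = (\<lambda>v. (1 / fact p) * (\<Sum>\<sigma> | \<sigma> permutes {..<p}. T (v \<circ> \<sigma>)))"

definition sym_power_prod :: "'a::euclidean_space \<Rightarrow> nat \<Rightarrow> 'a \<Rightarrow> nat \<Rightarrow> 'a tensor" where
  "sym_power_prod x r y s =
    symmetrization (r + s) (tensor_prod r (tensor_power x r) (tensor_power y s))"

text \<open>
  Integrals of tensor-valued functions are evaluated argumentwise, which in the
  finite-dimensional space of tensors is the vector-valued integral. The function
  \<^const>\<open>closest_point\<close> is total: where the closest point is not unique it makes an
  arbitrary, possibly not Borel measurable choice. As this happens only on a null set, the
  integral is taken with respect to the complete measure \<^const>\<open>lebesgue\<close>.
\<close>

definition voronoi_tensor_measure ::
    "real \<Rightarrow> nat \<Rightarrow> nat \<Rightarrow> 'a::euclidean_space set \<Rightarrow> 'a set \<Rightarrow> 'a tensor" where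
  "voronoi_tensor_measure R r s K A = (\<lambda>v.
     LINT x:parallel_set K R|lebesgue.
       indicator A (closest_point K x) *
       sym_power_prod (closest_point K x) r (x - closest_point K x) s v)"

text \<open>
  A finite signed Borel measure is encoded as a real function on sets, of which only the
  values on Borel sets matter. Its positive variation is
  \<open>\<mu>\<^sup>+ A = sup {\<mu> B | B \<subseteq> A}\<close>, with \<open>B\<close> ranging over Borel sets (the coercion
  \<^const>\<open>ennreal\<close> cuts off negative values, which do not affect the supremum as
  \<open>\<mu> {} = 0\<close>), the negative variation of \<open>\<mu>\<close> is \<open>(-\<mu>)\<^sup>+\<close>, and integration uses the Jordan
  decomposition \<open>\<mu> = \<mu>\<^sup>+ - \<mu>\<^sup>-\<close>.
\<close>

definition pos_variation :: "('a::euclidean_space set \<Rightarrow> real) \<Rightarrow> 'a measure" where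
  "pos_variation \<mu> = measure_of UNIV (sets borel)
     (\<lambda>A. SUP B\<in>{B\<in>sets borel. B \<subseteq> A}. ennreal (\<mu> B))"

definition signed_integral :: "('a::euclidean_space set \<Rightarrow> real) \<Rightarrow> ('a \<Rightarrow> real) \<Rightarrow> real" where
  "signed_integral \<mu> f =
     (LINT x|pos_variation \<mu>. f x) - (LINT x|pos_variation (\<lambda>A. - \<mu> A). f x)"

text \<open>For a tensor-valued measure \<open>\<mu>\<close>, again argumentwise.\<close>

definition tensor_integral ::
    "('a::euclidean_space set \<Rightarrow> 'a tensor) \<Rightarrow> ('a \<Rightarrow> real) \<Rightarrow> 'a tensor" where
  "tensor_integral \<mu> f = (\<lambda>v. signed_integral (\<lambda>A. \<mu> A v) f)"

definition bounded_Lipschitz :: "('a::euclidean_space \<Rightarrow> real) \<Rightarrow> bool" where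
  "bounded_Lipschitz f \<longleftrightarrow> bounded (range f) \<and> (\<exists>L. L-lipschitz_on UNIV f)"

definition Lip_seminorm :: "('a::euclidean_space \<Rightarrow> real) \<Rightarrow> real" where
  "Lip_seminorm f = (SUP (x, y)\<in>{(x, y). x \<noteq> y}. \<bar>f x - f y\<bar> / norm (x - y))"

definition bL_norm :: "('a::euclidean_space \<Rightarrow> real) \<Rightarrow> real" where
  "bL_norm f = Lip_seminorm f + (SUP x. \<bar>f x\<bar>)"

definition bL_dist ::
    "nat \<Rightarrow> ('a::euclidean_space set \<Rightarrow> 'a tensor) \<Rightarrow> ('a set \<Rightarrow> 'a tensor) \<Rightarrow> real" where
  "bL_dist p \<mu> \<nu> = (SUP f\<in>{f. bounded_Lipschitz f \<and> bL_norm f \<le> 1}.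
     tensor_norm p (\<lambda>v. tensor_integral \<mu> f v - tensor_integral \<nu> f v))"

end

theory Submission
  imports Defs
begin

text \<open>
  The closest point of \<open>K\<close> to \<open>x\<close> is a subgradient at \<open>x\<close> of the convex function
  \<open>\<phi>\<^sub>K x = (|x|\<^sup>2 - d\<^sub>K(x)\<^sup>2) / 2\<close>, and on bounded sets \<open>\<phi>\<^sub>K\<close> depends on \<open>K\<close> in a Lipschitz way
  with respect to the Hausdorff distance \<open>\<epsilon>\<close>. Comparing subgradients with difference quotients of
  step \<open>h\<close> bounds the components of \<open>p\<^sub>K - p\<^sub>K\<^sub>0\<close> by \<open>O(\<epsilon> / h)\<close> plus second differences of \<open>\<phi>\<^sub>K\<close> and
  \<open>\<phi>\<^sub>K\<^sub>0\<close> divided by \<open>h\<close>, and the integral of a second difference over a ball is \<open>O(h\<^sup>2)\<close>. With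
  \<open>h = \<surd>\<epsilon>\<close> this gives an \<open>L\<^sup>1\<close> bound of order \<open>\<surd>\<epsilon>\<close>.

  The symmetric difference of the parallel sets lies in two shells of width \<open>\<epsilon>\<close>. The volume of
  such a shell is \<open>O(\<epsilon>)\<close>: cut the compact set into boundedly many pieces of diameter at most
  \<open>R / 2\<close>; for each piece, a contraction by the factor \<open>1 - 2 \<epsilon> / R\<close> towards one of its points
  maps its \<open>R\<close>-parallel set into the \<open>(R - \<epsilon>)\<close>-parallel set.
\<close>

section \<open>Integration with respect to a signed push-forward measure\<close>

lemma integrable_bounded_mult:
  fixes f k :: "'b \<Rightarrow> real"
  assumes k: "integrable M k" and f[measurable]: "f \<in> borel_measurable M" and "bounded (range f)"
  shows "integrable M (\<lambda>x. f x * k x)"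
proof -
  obtain B where B: "\<And>y. \<bar>f y\<bar> \<le> B"
    using \<open>bounded (range f)\<close> by (auto simp: bounded_iff)
  show ?thesis
  proof (rule Bochner_Integration.integrable_bound)
    show "integrable M (\<lambda>x. B * k x)" using k by simp
    show "(\<lambda>x. f x * k x) \<in> borel_measurable M"
      using k by measurable
    have "\<bar>f y\<bar> \<le> \<bar>B\<bar>" for y using B[of y] by linarith
    then show "AE x in M. norm (f x * k x) \<le> norm (B * k x)"
      by (auto simp: abs_mult intro!: mult_right_mono)
  qed
qed

text \<open>The function \<open>h\<close> is the Radon-Nikodym derivative of the image under
  \<open>\<pi>\<close> of \<open>g\<close> times \<open>M\<close> with respect to the image of
  \<open>M\<close>. It exists because the preimage of a null set of the image measure is null for
  \<open>M\<close>, hence for \<open>g\<close> times \<open>M\<close>.\<close>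

lemma pushforward_density_nonneg:
  fixes g :: "'b \<Rightarrow> real" and \<pi> :: "'b \<Rightarrow> 'a::euclidean_space"
  assumes "finite_measure M" and \<pi>[measurable]: "\<pi> \<in> M \<rightarrow>\<^sub>M borel"
    and g: "integrable M g" and g0: "\<And>x. 0 \<le> g x"
  obtains h where "integrable (distr M borel \<pi>) h"
    and "\<And>f. f \<in> borel_measurable borel \<Longrightarrow> integrable M (\<lambda>x. f (\<pi> x) * g x) \<Longrightarrow>
      integrable (distr M borel \<pi>) (\<lambda>y. f y * h y)"
    and "\<And>f. f \<in> borel_measurable borel \<Longrightarrow>
      (LINT y|distr M borel \<pi>. f y * h y) = (LINT x|M. f (\<pi> x) * g x)"
proof -
  interpret M: finite_measure M by fact
  let ?N = "distr M borel \<pi>" and ?D = "density M (\<lambda>x. ennreal (g x))"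
  let ?N' = "distr ?D borel \<pi>"
  note [measurable] = borel_measurable_integrable[OF g]
  interpret N: finite_measure ?N by (rule M.finite_measure_distr) fact
  interpret D: finite_measure ?D
    by (rule finite_measureI)
      (use g g0 in \<open>simp add: emeasure_density nn_integral_eq_integral cong: nn_integral_cong\<close>)
  have \<pi>D: "\<pi> \<in> ?D \<rightarrow>\<^sub>M borel"
    by simp
  interpret N': finite_measure ?N' by (rule D.finite_measure_distr) fact
  have ac: "absolutely_continuous ?N ?N'"
    unfolding absolutely_continuous_def
  proof
    fix A assume "A \<in> null_sets ?N"
    then have A[measurable]: "A \<in> sets borel" and null: "\<pi> -` A \<inter> space M \<in> null_sets M"
      by (auto simp: null_sets_def emeasure_distr)
    then have "\<pi> -` A \<inter> space M \<in> null_sets ?D"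
      using absolutely_continuousI_density[of "\<lambda>x. ennreal (g x)" M]
      by (auto simp: absolutely_continuous_def)
    then show "A \<in> null_sets ?N'"
      by (auto simp: null_sets_def emeasure_distr[OF \<pi>D])
  qed
  have sets: "sets ?N' = sets ?N" by simp
  let ?h = "\<lambda>y. enn2real (RN_deriv ?N ?N' y)"
  have int: "integrable ?N (\<lambda>y. f y * ?h y)"
    if f[measurable]: "f \<in> borel_measurable borel" and i: "integrable M (\<lambda>x. f (\<pi> x) * g x)" for f
  proof -
    have "integrable ?N' f"
      unfolding integrable_distr_eq[OF \<pi>D f] using i g0
      by (subst integrable_density) (auto simp: mult.commute)
    then show ?thesis
      using N.RN_deriv_integrable[OF N'.sigma_finite_measure_axioms ac sets, of f] by (simp add: mult.commute)
  qed
  show ?thesis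
  proof (rule that[of ?h])
    show "integrable ?N ?h"
      using int[of "\<lambda>_. 1"] g by simp
  next
    fix f :: "'a \<Rightarrow> real" assume f[measurable]: "f \<in> borel_measurable borel"
    have "(LINT y|?N. f y * ?h y) = integral\<^sup>L ?N' f"
      using N.RN_deriv_integral[OF N'.sigma_finite_measure_axioms ac sets, of f] by (simp add: mult.commute)
    also have "\<dots> = (LINT x|?D. f (\<pi> x))"
      by (rule integral_distr[OF \<pi>D f])
    also have "\<dots> = (LINT x|M. f (\<pi> x) * g x)"
      using g0 by (subst integral_density) (auto simp: mult.commute)
    finally show "(LINT y|?N. f y * ?h y) = (LINT x|M. f (\<pi> x) * g x)" .
  qed (rule int)
qed

text \<open>The positive and negative parts of \<open>g\<close> are treated separately. Their images
  under \<open>\<pi>\<close> may overlap, so they need not be the Jordan decomposition of the image;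
  a single density \<open>h\<close> on the target space is what gives access to that
  decomposition.\<close>

lemma pushforward_density:
  fixes g :: "'b \<Rightarrow> real" and \<pi> :: "'b \<Rightarrow> 'a::euclidean_space"
  assumes M: "finite_measure M" and \<pi>[measurable]: "\<pi> \<in> M \<rightarrow>\<^sub>M borel"
    and g: "integrable M g"
  obtains h where "integrable (distr M borel \<pi>) h"
    and "\<And>f. f \<in> borel_measurable borel \<Longrightarrow> bounded (range f) \<Longrightarrow>
      (LINT y|distr M borel \<pi>. f y * h y) = (LINT x|M. f (\<pi> x) * g x)"
proof -
  let ?N = "distr M borel \<pi>"
  let ?p = "\<lambda>x. max 0 (g x)" and ?n = "\<lambda>x. max 0 (- g x)"
  have p: "integrable M ?p" and n: "integrable M ?n"
    using g by auto
  obtain h1 where h1: "integrable ?N h1"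
    and i1: "\<And>f. f \<in> borel_measurable borel \<Longrightarrow> integrable M (\<lambda>x. f (\<pi> x) * ?p x) \<Longrightarrow> integrable ?N (\<lambda>y. f y * h1 y)"
    and e1: "\<And>f. f \<in> borel_measurable borel \<Longrightarrow> (LINT y|?N. f y * h1 y) = (LINT x|M. f (\<pi> x) * ?p x)"
    by (rule pushforward_density_nonneg[OF M \<pi> p max.cobounded1]) blast
  obtain h2 where h2: "integrable ?N h2"
    and i2: "\<And>f. f \<in> borel_measurable borel \<Longrightarrow> integrable M (\<lambda>x. f (\<pi> x) * ?n x) \<Longrightarrow> integrable ?N (\<lambda>y. f y * h2 y)"
    and e2: "\<And>f. f \<in> borel_measurable borel \<Longrightarrow> (LINT y|?N. f y * h2 y) = (LINT x|M. f (\<pi> x) * ?n x)"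
    by (rule pushforward_density_nonneg[OF M \<pi> n max.cobounded1]) blast
  show ?thesis
  proof (rule that[of "\<lambda>y. h1 y - h2 y"])
    show "integrable ?N (\<lambda>y. h1 y - h2 y)" using h1 h2 by simp
    fix f :: "'a \<Rightarrow> real" assume f[measurable]: "f \<in> borel_measurable borel" and "bounded (range f)"
    then have bd: "integrable M (\<lambda>x. f (\<pi> x) * k x)" if "integrable M k" for k :: "'b \<Rightarrow> real"
      using that by (intro integrable_bounded_mult) (auto intro: bounded_subset)
    have "(LINT y|?N. f y * (h1 y - h2 y)) = (LINT x|M. f (\<pi> x) * ?p x) - (LINT x|M. f (\<pi> x) * ?n x)"
      unfolding right_diff_distrib
      using i1[OF f bd[OF p]] i2[OF f bd[OF n]] e1[OF f] e2[OF f] by simp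
    also have "\<dots> = (LINT x|M. f (\<pi> x) * ?p x - f (\<pi> x) * ?n x)"
      using bd[OF p] bd[OF n] by simp
    also have "\<dots> = (LINT x|M. f (\<pi> x) * g x)"
      by (rule Bochner_Integration.integral_cong) (auto simp: max_def)
    finally show "(LINT y|?N. f y * (h1 y - h2 y)) = (LINT x|M. f (\<pi> x) * g x)" .
  qed
qed

text \<open>The positive variation of a signed measure with density \<open>h\<close> has density \<open>h\<^sup>+\<close>, since the
  supremum over \<open>B \<subseteq> A\<close> is attained at \<open>B = A \<inter> {h > 0}\<close>.\<close>

lemma pos_variation_density:
  fixes h :: "'a::euclidean_space \<Rightarrow> real"
  assumes sets[measurable_cong]: "sets N = sets borel" and h: "integrable N h"
    and \<mu>: "\<And>A. A \<in> sets borel \<Longrightarrow> \<mu> A = (LINT y|N. indicator A y * h y)"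
  shows "pos_variation \<mu> = density N (\<lambda>y. ennreal (h y))"
proof -
  let ?D = "density N (\<lambda>y. ennreal (h y))"
  note [measurable] = borel_measurable_integrable[OF h]
  have space: "space N = UNIV"
    using sets_eq_imp_space_eq[OF sets] by simp
  have int: "integrable N (\<lambda>y. indicator A y * h y)" if [measurable]: "A \<in> sets borel" for A
    using integrable_mult_indicator[OF _ h, of A] sets that by simp
  have eq: "(SUP B\<in>{B\<in>sets borel. B \<subseteq> A}. ennreal (\<mu> B)) = emeasure ?D A"
    if [measurable]: "A \<in> sets borel" for A
  proof (rule antisym)
    have "ennreal (\<mu> B) \<le> emeasure ?D A" if [measurable]: "B \<in> sets borel" and "B \<subseteq> A" for B
    proof -
      have "ennreal (\<mu> B) \<le> ennreal (LINT y|N. max 0 (indicator B y * h y))"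
        unfolding \<mu>[OF that(1)] by (intro ennreal_leI integral_mono int integrable_max) auto
      also have "\<dots> = (\<integral>\<^sup>+y. ennreal (max 0 (indicator B y * h y)) \<partial>N)"
        by (intro nn_integral_eq_integral[symmetric] integrable_max int) auto
      also have "\<dots> \<le> (\<integral>\<^sup>+y. ennreal (h y) * indicator A y \<partial>N)"
        using \<open>B \<subseteq> A\<close> by (intro nn_integral_mono) (auto simp: indicator_def max_def ennreal_neg)
      also have "\<dots> = emeasure ?D A"
        by (subst emeasure_density) auto
      finally show ?thesis .
    qed
    then show "(SUP B\<in>{B\<in>sets borel. B \<subseteq> A}. ennreal (\<mu> B)) \<le> emeasure ?D A"
      by (intro SUP_least) auto
  next
    let ?B = "A \<inter> {y. 0 < h y}"
    have "{y \<in> space N. 0 < h y} \<in> sets N"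
      by measurable
    then have [measurable]: "{y. 0 < h y} \<in> sets borel"
      by (simp add: space sets)
    have B[measurable]: "?B \<in> sets borel" by measurable
    have "emeasure ?D A = (\<integral>\<^sup>+y. ennreal (h y) * indicator A y \<partial>N)"
      by (subst emeasure_density) auto
    also have "\<dots> = (\<integral>\<^sup>+y. ennreal (indicator ?B y * h y) \<partial>N)"
      by (intro nn_integral_cong) (auto simp: indicator_def ennreal_neg)
    also have "\<dots> = ennreal (\<mu> ?B)"
      unfolding \<mu>[OF B] by (intro nn_integral_eq_integral int) (auto simp: indicator_def)
    also have "\<dots> \<le> (SUP B\<in>{B\<in>sets borel. B \<subseteq> A}. ennreal (\<mu> B))"
      by (intro SUP_upper) auto
    finally show "emeasure ?D A \<le> (SUP B\<in>{B\<in>sets borel. B \<subseteq> A}. ennreal (\<mu> B))" .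
  qed
  \<comment> \<open>The supremum formula and \<open>emeasure ?D\<close> have been compared on Borel
    sets only; \<open>measure_of\<close> depends on nothing else.\<close>
  have "pos_variation \<mu> = measure_of UNIV (sets borel) (emeasure ?D)"
    unfolding pos_variation_def
    using sets.sigma_sets_eq[of "borel :: 'a measure"] by (intro measure_of_eq) (auto simp: eq)
  also have "\<dots> = ?D"
    using measure_of_of_measure[of ?D] by (simp add: space sets)
  finally show ?thesis .
qed

lemma signed_integral_density:
  fixes h f :: "'a::euclidean_space \<Rightarrow> real"
  assumes sets[measurable_cong]: "sets N = sets borel" and h: "integrable N h"
    and \<mu>: "\<And>A. A \<in> sets borel \<Longrightarrow> \<mu> A = (LINT y|N. indicator A y * h y)"
    and f[measurable]: "f \<in> borel_measurable borel" and "bounded (range f)"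
  shows "signed_integral \<mu> f = (LINT y|N. f y * h y)"
proof -
  note [measurable] = borel_measurable_integrable[OF h]
  have *: "integrable N (\<lambda>y. max 0 (k y) * f y) \<and>
      integral\<^sup>L (density N (\<lambda>y. ennreal (k y))) f = (LINT y|N. max 0 (k y) * f y)"
    if k: "integrable N k" for k
  proof
    note [measurable] = borel_measurable_integrable[OF k]
    show "integrable N (\<lambda>y. max 0 (k y) * f y)"
      using integrable_bounded_mult[of N "\<lambda>y. max 0 (k y)" f] k \<open>bounded (range f)\<close>
      by (simp add: mult.commute)
    \<comment> \<open>\<open>ennreal\<close> cuts off negative values; making the cut explicit gives
      the nonnegative real density that \<open>integral_density\<close> asks for.\<close>
    have "density N (\<lambda>y. ennreal (k y)) = density N (\<lambda>y. ennreal (max 0 (k y)))"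
      by (intro density_cong) (auto simp: max_def ennreal_neg)
    then show "integral\<^sup>L (density N (\<lambda>y. ennreal (k y))) f = (LINT y|N. max 0 (k y) * f y)"
      by (simp add: integral_density)
  qed
  have pos: "pos_variation \<mu> = density N (\<lambda>y. ennreal (h y))"
    by (intro pos_variation_density sets h \<mu>)
  have neg: "pos_variation (\<lambda>A. - \<mu> A) = density N (\<lambda>y. ennreal (- h y))"
    using h by (intro pos_variation_density sets) (auto simp: \<mu>)
  have "signed_integral \<mu> f =
      (LINT y|N. max 0 (h y) * f y) - (LINT y|N. max 0 (- h y) * f y)"
    unfolding signed_integral_def pos neg
    using *[of h] *[of "\<lambda>y. - h y"] h by simp
  also have "\<dots> = (LINT y|N. max 0 (h y) * f y - max 0 (- h y) * f y)"
    using *[of h] *[of "\<lambda>y. - h y"] h by simp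
  also have "\<dots> = (LINT y|N. f y * h y)"
    by (rule Bochner_Integration.integral_cong) (auto simp: max_def)
  finally show ?thesis .
qed

text \<open>Change of variables for signed measures. With indicators as test functions,
  \<open>pushforward_density\<close> says that \<open>h\<close> is a density of the signed image
  measure; with \<open>f\<close> itself it evaluates the resulting integral.\<close>

lemma signed_integral_pushforward:
  fixes g :: "'b \<Rightarrow> real" and \<pi> :: "'b \<Rightarrow> 'a::euclidean_space"
  assumes M: "finite_measure M" and \<pi>: "\<pi> \<in> M \<rightarrow>\<^sub>M borel" and g: "integrable M g"
    and f: "f \<in> borel_measurable borel" "bounded (range f)"
  shows "signed_integral (\<lambda>A. LINT x|M. indicator A (\<pi> x) * g x) f = (LINT x|M. f (\<pi> x) * g x)"
proof -
  obtain h where h: "integrable (distr M borel \<pi>) h"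
    and e: "\<And>f. f \<in> borel_measurable borel \<Longrightarrow> bounded (range f) \<Longrightarrow>
      (LINT y|distr M borel \<pi>. f y * h y) = (LINT x|M. f (\<pi> x) * g x)"
    using pushforward_density[OF M \<pi> g] by blast
  have "bounded (range (indicator A :: 'a \<Rightarrow> real))" for A
    by (auto simp: bounded_iff indicator_def intro!: exI[of _ 1])
  then have "signed_integral (\<lambda>A. LINT x|M. indicator A (\<pi> x) * g x) f
      = (LINT y|distr M borel \<pi>. f y * h y)"
    by (intro signed_integral_density h f) (auto simp: e)
  then show ?thesis by (simp add: e f)
qed

section \<open>The convex potential of the closest point map\<close>

text \<open>For nonempty closed \<open>K\<close> this is the maximum over \<open>q\<close> in
  \<open>K\<close> of the affine functions \<open>q \<bullet> x - (norm q)\<^sup>2 / 2\<close>,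
  attained at the closest point: the convex conjugate of half the squared norm restricted to
  \<open>K\<close>.\<close>

definition potential :: "'a::euclidean_space set \<Rightarrow> 'a \<Rightarrow> real" where
  "potential K x = ((norm x)\<^sup>2 - (infdist x K)\<^sup>2) / 2"

lemma infdist_closest_point:
  fixes K :: "'a::euclidean_space set"
  assumes "closed K" "K \<noteq> {}"
  shows "infdist x K = dist x (closest_point K x)"
proof (rule antisym)
  show "infdist x K \<le> dist x (closest_point K x)"
    using assms by (intro infdist_le closest_point_in_set)
  show "dist x (closest_point K x) \<le> infdist x K"
    unfolding infdist_notempty[OF \<open>K \<noteq> {}\<close>]
    using assms by (intro cINF_greatest) (auto intro: closest_point_le)
qed

lemma potential_eq_inner:
  fixes K :: "'a::euclidean_space set"
  assumes "closed K" "K \<noteq> {}"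
  shows "potential K x = closest_point K x \<bullet> x - (norm (closest_point K x))\<^sup>2 / 2"
  unfolding potential_def infdist_closest_point[OF assms] dist_norm power2_norm_eq_inner
  by (simp add: algebra_simps diff_divide_distrib inner_commute)

lemma inner_le_potential:
  fixes K :: "'a::euclidean_space set"
  assumes "q \<in> K"
  shows "q \<bullet> x - (norm q)\<^sup>2 / 2 \<le> potential K x"
proof -
  have "(infdist x K)\<^sup>2 \<le> (dist x q)\<^sup>2"
    by (intro power_mono infdist_le assms infdist_nonneg)
  then show ?thesis
    unfolding potential_def dist_norm power2_norm_eq_inner
    by (simp add: algebra_simps inner_commute)
qed

text \<open>The affine function belonging to \<open>closest_point K x\<close> touches the potential
  at \<open>x\<close> and stays below it at \<open>x + y\<close>.\<close>

lemma potential_subgradient: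
  fixes K :: "'a::euclidean_space set"
  assumes "closed K" "K \<noteq> {}"
  shows "closest_point K x \<bullet> y \<le> potential K (x + y) - potential K x"
  using inner_le_potential[OF closest_point_in_set[OF assms], of x "x + y"] potential_eq_inner[OF assms, of x]
  by (simp add: inner_add_right)

text \<open>The subgradient at \<open>x\<close> bounds the difference from below and the one at
  \<open>x + y\<close> bounds it from above; both are points of \<open>K\<close>.\<close>

lemma potential_diff_le:
  fixes K :: "'a::euclidean_space set"
  assumes K: "closed K" "K \<noteq> {}" "K \<subseteq> cball 0 \<rho>"
  shows "\<bar>potential K (x + y) - potential K x\<bar> \<le> \<rho> * norm y"
proof -
  have *: "\<bar>closest_point K z \<bullet> y\<bar> \<le> \<rho> * norm y" for z
  proof -
    have "norm (closest_point K z) \<le> \<rho>"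
      using closest_point_in_set[OF K(1,2), of z] K(3) by auto
    then show ?thesis
      by (intro order_trans[OF Cauchy_Schwarz_ineq2] mult_right_mono) auto
  qed
  show ?thesis
    using potential_subgradient[OF K(1,2), of x y] potential_subgradient[OF K(1,2), of "x + y" "- y"]
      *[of x] *[of "x + y"] by auto
qed

lemma continuous_on_potential [continuous_intros]:
  "continuous_on S f \<Longrightarrow> continuous_on S (\<lambda>x. potential K (f x))"
  unfolding potential_def by (intro continuous_intros) auto

lemma borel_measurable_potential [measurable]: "potential K \<in> borel_measurable borel"
  by (intro borel_measurable_continuous_onI continuous_intros)

text \<open>The maximum defining the potential of \<open>K\<^sub>0\<close> is tested with the point
  \<open>q\<close> of \<open>K\<^sub>0\<close> closest to the maximizer \<open>p\<close> for
  \<open>K\<close>. The two affine functions differ by the inner product of \<open>p - q\<close>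
  with \<open>x\<close> minus the midpoint of \<open>p\<close> and \<open>q\<close>, and the
  midpoint has norm at most \<rho>.\<close>

lemma potential_le_of_subset_parallel:
  fixes K K\<^sub>0 :: "'a::euclidean_space set"
  assumes K: "closed K" "K \<noteq> {}" "K \<subseteq> cball 0 \<rho>"
    and K0: "closed K\<^sub>0" "K\<^sub>0 \<noteq> {}" "K\<^sub>0 \<subseteq> cball 0 \<rho>"
    and sub: "K \<subseteq> parallel_set K\<^sub>0 \<epsilon>"
  shows "potential K x - potential K\<^sub>0 x \<le> (norm x + \<rho>) * \<epsilon>"
proof -
  define p where "p = closest_point K x"
  define q where "q = closest_point K\<^sub>0 p"
  have p: "p \<in> K" and q: "q \<in> K\<^sub>0"
    using K K0 by (auto simp: p_def q_def intro: closest_point_in_set)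
  have "infdist p K\<^sub>0 \<le> \<epsilon>"
    using p sub by (auto simp: parallel_set_def)
  then have pq: "norm (p - q) \<le> \<epsilon>"
    unfolding infdist_closest_point[OF K0(1,2)] q_def by (simp add: dist_norm)
  have n: "norm p \<le> \<rho>" "norm q \<le> \<rho>"
    using p q K(3) K0(3) by auto
  have "potential K x - potential K\<^sub>0 x \<le> (p \<bullet> x - (norm p)\<^sup>2 / 2) - (q \<bullet> x - (norm q)\<^sup>2 / 2)"
    using inner_le_potential[OF q, of x] potential_eq_inner[OF K(1,2), of x] by (simp add: p_def)
  also have "\<dots> = (p - q) \<bullet> (x - (1/2) *\<^sub>R (p + q))"
    unfolding power2_norm_eq_inner by (simp add: algebra_simps inner_commute)
  also have "\<dots> \<le> norm (p - q) * norm (x - (1/2) *\<^sub>R (p + q))"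
    by (rule norm_cauchy_schwarz)
  also have "\<dots> \<le> \<epsilon> * (norm x + \<rho>)"
  proof (intro mult_mono pq)
    have "norm (x - (1/2) *\<^sub>R (p + q)) \<le> norm x + norm ((1/2) *\<^sub>R (p + q))"
      by (rule norm_triangle_ineq4)
    also have "norm ((1/2) *\<^sub>R (p + q)) \<le> \<rho>"
      using norm_triangle_ineq[of p q] n by simp
    finally show "norm (x - (1/2) *\<^sub>R (p + q)) \<le> norm x + \<rho>" by simp
    show "0 \<le> \<epsilon>" using norm_ge_zero pq by (rule order_trans)
  qed auto
  finally show ?thesis by (simp add: mult.commute)
qed

section \<open>Second differences of the potential and their integrals\<close>

definition second_difference :: "('a::real_vector \<Rightarrow> real) \<Rightarrow> 'a \<Rightarrow> 'a \<Rightarrow> real" where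
  "second_difference f y x = f (x + y) - 2 * f x + f (x - y)"

lemma second_difference_potential_nonneg:
  fixes K :: "'a::euclidean_space set"
  assumes "closed K" "K \<noteq> {}"
  shows "0 \<le> second_difference (potential K) y x"
  using potential_subgradient[OF assms, of x y] potential_subgradient[OF assms, of x "- y"]
  by (simp add: second_difference_def)

text \<open>The counterpart of \<open>potential_subgradient\<close>: applying the subgradient
  inequality to \<open>- y\<close> shows that the forward difference exceeds
  \<open>closest_point K x \<bullet> y\<close> by at most the second difference.\<close>

lemma forward_difference_potential_le:
  fixes K :: "'a::euclidean_space set"
  assumes "closed K" "K \<noteq> {}"
  shows "potential K (x + y) - potential K x \<le>
    closest_point K x \<bullet> y + second_difference (potential K) y x"
  using potential_subgradient[OF assms, of x "- y"]
  by (simp add: second_difference_def)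

lemma lborel_integral_translation:
  fixes f :: "'a::euclidean_space \<Rightarrow> real"
  assumes "f \<in> borel_measurable borel"
  shows "(LINT x|lborel. f (c + x)) = (LINT x|lborel. f x)"
  using integral_distr[of "(+) c" lborel borel f] assms by (simp add: lborel_distr_plus)

lemma integrable_continuous_compact_support:
  fixes f :: "'a::euclidean_space \<Rightarrow> real"
  assumes "continuous_on UNIV f" and "compact S" and "\<And>x. x \<notin> S \<Longrightarrow> f x = 0"
  shows "integrable lborel f"
proof -
  have "(\<lambda>x. indicator S x *\<^sub>R f x) = f"
    using assms(3) by (auto simp: fun_eq_iff indicator_def)
  then show ?thesis
    using borel_integrable_compact[of S f] assms by (auto intro: continuous_on_subset)
qed

text \<open>Shifting one of the two differences onto a Lipschitz cutoff function \<open>w\<close> gains a second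
  factor \<open>norm y\<close>.\<close>

lemma integral_second_difference_le:
  fixes K :: "'a::euclidean_space set"
  assumes K: "closed K" "K \<noteq> {}" "K \<subseteq> cball 0 \<rho>" and "0 \<le> \<rho>" and "norm y \<le> H"
  shows "set_integrable lborel (cball 0 M) (second_difference (potential K) y)"
    and "(LINT x:cball 0 M|lborel. second_difference (potential K) y x)
      \<le> \<rho> * (norm y)\<^sup>2 * measure lborel (cball (0::'a) (M + 1 + H))"
proof -
  \<comment> \<open>The cutoff is 1-Lipschitz, at least 1 on \<open>cball 0 M\<close> and zero
    outside radius \<open>M + 1\<close>; enlarging the radius by \<open>H\<close> also covers the
    support of its translate by \<open>y\<close>.\<close>
  define w where "w x = max 0 (M + 1 - norm x)" for x :: 'a
  define \<psi> where "\<psi> x = potential K (x + y) - potential K x" for x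
  let ?\<phi> = "potential K"
  let ?S = "cball (0::'a) (M + 1 + H)"
  have H: "0 \<le> H" using norm_ge_zero \<open>norm y \<le> H\<close> by (rule order_trans)
  have cw: "continuous_on UNIV w" unfolding w_def by (intro continuous_intros)
  have c\<psi>: "continuous_on UNIV \<psi>" unfolding \<psi>_def by (intro continuous_intros)
  have supp: "w x = 0" if "x \<notin> ?S" for x
    using that H by (auto simp: w_def)
  have supp': "w (y + x) = 0" if "x \<notin> ?S" for x
    using that H norm_triangle_ineq4[of "y + x" y] \<open>norm y \<le> H\<close> by (auto simp: w_def)
  have 2: "second_difference ?\<phi> y x = \<psi> x - \<psi> (x - y)" for x
    by (simp add: second_difference_def \<psi>_def)
  have cD: "continuous_on UNIV (second_difference ?\<phi> y)"
    unfolding second_difference_def by (intro continuous_intros)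
  show *: "set_integrable lborel (cball 0 M) (second_difference ?\<phi> y)"
    unfolding set_integrable_def
    by (intro borel_integrable_compact continuous_on_subset[OF cD]) auto
  have i1: "integrable lborel (\<lambda>x. w x * \<psi> x)"
    by (rule integrable_continuous_compact_support[of _ ?S])
       (auto intro!: continuous_on_mult cw c\<psi> simp del: mem_cball simp: supp)
  have i2: "integrable lborel (\<lambda>x. w (y + x) * \<psi> x)"
    by (rule integrable_continuous_compact_support[of _ ?S])
       (auto intro!: continuous_on_mult c\<psi> continuous_on_compose2[OF cw] continuous_intros
         simp del: mem_cball simp: supp')
  have i3: "integrable lborel (\<lambda>x. w x * \<psi> (x - y))"
    by (rule integrable_continuous_compact_support[of _ ?S])
       (auto intro!: continuous_on_mult cw continuous_on_compose2[OF c\<psi>] continuous_intros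
         simp del: mem_cball simp: supp)
  have iS: "integrable lborel (\<lambda>x. indicator ?S x * (\<rho> * (norm y)\<^sup>2))"
    using borel_integrable_compact[of ?S "\<lambda>_. \<rho> * (norm y)\<^sup>2"] by simp
  \<comment> \<open>Passing from the indicator to the larger function \<open>w\<close> is allowed
    because second differences of a convex function are nonnegative.\<close>
  have "(LINT x:cball 0 M|lborel. second_difference ?\<phi> y x)
      \<le> (LINT x|lborel. w x * second_difference ?\<phi> y x)"
    unfolding set_lebesgue_integral_def
  proof (rule integral_mono)
    show "integrable lborel (\<lambda>x. indicator (cball 0 M) x *\<^sub>R second_difference ?\<phi> y x)"
      using * unfolding set_integrable_def .
    show "integrable lborel (\<lambda>x. w x * second_difference ?\<phi> y x)"
      unfolding 2 right_diff_distrib using i1 i3 by simp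
    have "indicator (cball 0 M) x \<le> w x" for x
      by (auto simp: indicator_def w_def)
    then show "indicator (cball 0 M) x *\<^sub>R second_difference ?\<phi> y x \<le> w x * second_difference ?\<phi> y x" for x
      unfolding real_scaleR_def
      by (intro mult_right_mono second_difference_potential_nonneg K(1,2))
  qed
  also have "\<dots> = (LINT x|lborel. w x * \<psi> x) - (LINT x|lborel. w x * \<psi> (x - y))"
    unfolding 2 right_diff_distrib using i1 i3 by simp
  also have "(LINT x|lborel. w x * \<psi> (x - y)) = (LINT x|lborel. w (y + x) * \<psi> x)"
    using lborel_integral_translation[of "\<lambda>x. w x * \<psi> (x - y)" y] i3 by simp
  also have "(LINT x|lborel. w x * \<psi> x) - \<dots> = (LINT x|lborel. w x * \<psi> x - w (y + x) * \<psi> x)"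
    using i1 i2 by simp
  also have "\<dots> \<le> (LINT x|lborel. indicator ?S x * (\<rho> * (norm y)\<^sup>2))"
  proof (intro integral_mono iS)
    show "integrable lborel (\<lambda>x. w x * \<psi> x - w (y + x) * \<psi> x)"
      using i1 i2 by simp
    fix x
    show "w x * \<psi> x - w (y + x) * \<psi> x \<le> indicator ?S x * (\<rho> * (norm y)\<^sup>2)"
    proof (cases "x \<in> ?S")
      case True
      have "\<bar>w x - w (y + x)\<bar> \<le> norm y"
        using norm_triangle_ineq[of y x] norm_triangle_ineq4[of "y + x" y]
        by (auto simp: w_def max_def)
      \<comment> \<open>One factor \<open>norm y\<close> comes from the cutoff, the other from the
        Lipschitz bound for the potential.\<close>
      then have "\<bar>w x - w (y + x)\<bar> * \<bar>\<psi> x\<bar> \<le> norm y * (\<rho> * norm y)"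
        using potential_diff_le[OF K, of x y] by (intro mult_mono) (auto simp: \<psi>_def)
      then have "\<bar>(w x - w (y + x)) * \<psi> x\<bar> \<le> \<rho> * (norm y)\<^sup>2"
        by (simp add: abs_mult power2_eq_square mult_ac)
      then show ?thesis
        using True by (simp add: left_diff_distrib)
    next
      case False
      then show ?thesis using supp supp' by simp
    qed
  qed
  also have "\<dots> = \<rho> * (norm y)\<^sup>2 * measure lborel ?S"
    by (simp add: mult.commute)
  finally show "(LINT x:cball 0 M|lborel. second_difference ?\<phi> y x) \<le> \<rho> * (norm y)\<^sup>2 * measure lborel ?S" .
qed

section \<open>Closest point maps\<close>

text \<open>No uniqueness of closest points is needed: \<open>closest_point K x \<bullet> e\<close> lies below all forward
  difference quotients of the potential in direction \<open>e\<close>, and almost everywhere it is their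
  infimum because the second differences have small integral.\<close>

lemma AE_INF_second_difference_potential:
  fixes K :: "'a::euclidean_space set"
  assumes K: "compact K" "K \<noteq> {}" and e: "norm e = 1"
  shows "AE x in lborel. (INF n. ennreal (real (Suc n) *
    second_difference (potential K) (e /\<^sub>R real (Suc n)) x)) = 0"
proof -
  define G where "G n x = real (Suc n) * second_difference (potential K) (e /\<^sub>R real (Suc n)) x" for n x
  have cl: "closed K" using K by (auto intro: compact_imp_closed)
  obtain \<rho> where "0 < \<rho>" "\<forall>x\<in>K. norm x \<le> \<rho>"
    using compact_imp_bounded[OF K(1)] unfolding bounded_pos by auto
  then have \<rho>: "0 < \<rho>" "K \<subseteq> cball 0 \<rho>" by auto
  have ne: "norm (e /\<^sub>R real (Suc n)) = inverse (real (Suc n))" for n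
    using e by simp
  have Gm[measurable]: "G n \<in> borel_measurable borel" for n
    unfolding G_def second_difference_def by measurable
  have "AE x in lborel. x \<in> cball 0 (real m) \<longrightarrow> (INF n. ennreal (G n x)) = 0" for m
  proof -
    let ?E = "cball (0::'a) (real m)"
    \<comment> \<open>The last 1 is the common bound \<open>H\<close> for all step lengths
      \<open>1 / Suc n\<close>, so that \<open>V\<close> does not depend on
      \<open>n\<close>.\<close>
    define V where "V = measure lborel (cball (0::'a) (real m + 1 + 1))"
    \<comment> \<open>The infimum lies below \<open>G n\<close>, whose integral is
      \<open>Suc n\<close> times a bound quadratic in the step \<open>1 / Suc n\<close>; this tends
      to 0.\<close>
    have le: "(\<integral>\<^sup>+x. indicator ?E x * (INF n. ennreal (G n x)) \<partial>lborel) \<le> ennreal (\<rho> * V / real (Suc n))" for n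
    proof -
      have small: "inverse (real (Suc n)) \<le> 1" by (simp add: inverse_le_1_iff)
      note D = integral_second_difference_le[OF cl K(2) \<rho>(2) less_imp_le[OF \<rho>(1)],
        of "e /\<^sub>R real (Suc n)" 1 "real m", unfolded ne, OF small]
      have "(\<integral>\<^sup>+x. indicator ?E x * (INF n. ennreal (G n x)) \<partial>lborel) \<le>
          (\<integral>\<^sup>+x. ennreal (indicator ?E x *\<^sub>R G n x) \<partial>lborel)"
        by (intro nn_integral_mono) (auto simp: indicator_def intro: INF_lower)
      also have "\<dots> = ennreal (LINT x:?E|lborel. G n x)"
        unfolding set_lebesgue_integral_def
      proof (rule nn_integral_eq_integral)
        show "integrable lborel (\<lambda>x. indicator ?E x *\<^sub>R G n x)"
          using D(1) unfolding set_integrable_def G_def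
          by (simp add: mult.left_commute del: of_nat_Suc)
        show "AE x in lborel. 0 \<le> indicator ?E x *\<^sub>R G n x"
          using second_difference_potential_nonneg[OF cl K(2)]
          by (auto simp: G_def indicator_def)
      qed
      also have "(LINT x:?E|lborel. G n x) =
          real (Suc n) * (LINT x:?E|lborel. second_difference (potential K) (e /\<^sub>R real (Suc n)) x)"
        by (simp add: G_def del: of_nat_Suc)
      also have "\<dots> \<le> real (Suc n) * (\<rho> * (inverse (real (Suc n)))\<^sup>2 * V)"
        using D(2) unfolding V_def by (intro mult_left_mono) auto
      also have "\<dots> = \<rho> * V / real (Suc n)"
        by (simp add: power2_eq_square field_simps del: of_nat_Suc)
      finally show ?thesis by (simp add: ennreal_leI)
    qed
    have "(\<lambda>n. ennreal (\<rho> * V / real (Suc n))) \<longlonglongrightarrow> ennreal 0"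
      by (intro tendsto_ennrealI LIMSEQ_Suc lim_const_over_n)
    then have "(\<integral>\<^sup>+x. indicator ?E x * (INF n. ennreal (G n x)) \<partial>lborel) \<le> 0"
      using le by (intro LIMSEQ_le_const) auto
    moreover have "(\<lambda>x. indicator ?E x * (INF n. ennreal (G n x))) \<in> borel_measurable lborel"
      by (intro borel_measurable_times_ennreal borel_measurable_indicator borel_measurable_INF) auto
    ultimately have "AE x in lborel. indicator ?E x * (INF n. ennreal (G n x)) = 0"
      by (simp add: nn_integral_0_iff_AE)
    then show ?thesis
      by eventually_elim auto
  qed
  then have "AE x in lborel. \<forall>m. x \<in> cball 0 (real m) \<longrightarrow> (INF n. ennreal (G n x)) = 0"
    unfolding AE_all_countable by blast
  then have "AE x in lborel. (INF n. ennreal (G n x)) = 0"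
  proof eventually_elim
    case (elim x)
    obtain m where "norm x \<le> real m" using real_arch_simple by blast
    then show ?case using elim by (metis dist_0_norm mem_cball)
  qed
  then show ?thesis unfolding G_def .
qed

text \<open>Each coordinate agrees almost everywhere with the infimum of countably many Borel
  functions \<open>q n\<close>, and the completeness of \<open>lebesgue\<close> absorbs the
  arbitrary choices on the exceptional null set.\<close>

lemma borel_measurable_closest_point:
  fixes K :: "'a::euclidean_space set"
  assumes K: "compact K" "K \<noteq> {}"
  shows "closest_point K \<in> borel_measurable lebesgue"
  unfolding borel_measurable_euclidean_space[of "closest_point K"]
proof
  fix e :: 'a assume "e \<in> Basis"
  then have e: "norm e = 1" by simp
  have cl: "closed K" using K by (auto intro: compact_imp_closed)
  define q where "q n x = real (Suc n) * (potential K (x + e /\<^sub>R real (Suc n)) - potential K x)" for n x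
  define G where "G n x = real (Suc n) * second_difference (potential K) (e /\<^sub>R real (Suc n)) x" for n x
  have qm[measurable]: "q n \<in> borel_measurable borel" for n
    unfolding q_def by measurable
  have low: "closest_point K x \<bullet> e \<le> q n x" for n x
  proof -
    have "closest_point K x \<bullet> e = real (Suc n) * (closest_point K x \<bullet> (e /\<^sub>R real (Suc n)))"
      by (simp del: of_nat_Suc)
    also have "\<dots> \<le> q n x"
      unfolding q_def by (intro mult_left_mono potential_subgradient cl K) auto
    finally show ?thesis .
  qed
  have up: "q n x \<le> closest_point K x \<bullet> e + G n x" for n x
  proof -
    have "q n x \<le> real (Suc n) * (closest_point K x \<bullet> (e /\<^sub>R real (Suc n)) +
        second_difference (potential K) (e /\<^sub>R real (Suc n)) x)"
      unfolding q_def by (intro mult_left_mono forward_difference_potential_le cl K) auto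
    also have "\<dots> = closest_point K x \<bullet> e + G n x"
      unfolding G_def by (simp add: distrib_left del: of_nat_Suc)
    finally show ?thesis .
  qed
  have "AE x in lebesgue. (INF n. q n x) = closest_point K x \<bullet> e"
    using AE_completion[OF AE_INF_second_difference_potential[OF K e]]
  proof eventually_elim
    case (elim x)
    have bdd: "bdd_below (range (\<lambda>n. q n x))"
      using low by (intro bdd_belowI[of _ "closest_point K x \<bullet> e"]) auto
    show ?case
    proof (rule antisym)
      show "closest_point K x \<bullet> e \<le> (INF n. q n x)"
        by (intro cINF_greatest low) auto
      show "(INF n. q n x) \<le> closest_point K x \<bullet> e"
      proof (rule field_le_epsilon)
        fix \<delta> :: real assume "0 < \<delta>"
        then have "(INF n. ennreal (G n x)) < ennreal \<delta>"
          using elim by (simp add: G_def)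
        \<comment> \<open>For this \<open>n\<close> the difference quotient \<open>q n x\<close>
          exceeds \<open>closest_point K x \<bullet> e\<close> by less than \<delta>.\<close>
        then obtain n where "ennreal (G n x) < ennreal \<delta>"
          unfolding INF_less_iff by auto
        then have "G n x < \<delta>"
          using \<open>0 < \<delta>\<close> by (metis ennreal_leI not_less)
        then show "(INF n. q n x) \<le> closest_point K x \<bullet> e + \<delta>"
          using cINF_lower[OF bdd, of n] up[of n x] by simp
      qed
    qed
  qed
  moreover have "(\<lambda>x. INF n. q n x) \<in> borel_measurable lebesgue"
    by (intro measurable_completion) measurable
  ultimately show "(\<lambda>x. closest_point K x \<bullet> e) \<in> borel_measurable lebesgue"
    by (rule borel_measurable_AE[rotated])
qed

section \<open>Stability of the closest point map in the mean\<close>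

lemma norm_closest_point_le:
  fixes K :: "'a::euclidean_space set"
  assumes "closed K" "K \<noteq> {}" "K \<subseteq> cball 0 \<rho>"
  shows "norm (closest_point K x) \<le> \<rho>"
  using closest_point_in_set[OF assms(1,2), of x] assms(3) by auto

lemma set_integrable_closest_point_diff:
  fixes K :: "'a::euclidean_space set"
  assumes K: "compact K" "K \<noteq> {}" and K0: "compact K\<^sub>0" "K\<^sub>0 \<noteq> {}" and E: "E \<in> lmeasurable"
  shows "set_integrable lebesgue E (\<lambda>x. norm (closest_point K x - closest_point K\<^sub>0 x))"
proof -
  note [measurable] = borel_measurable_closest_point[OF K] borel_measurable_closest_point[OF K0]
  have [measurable]: "E \<in> sets lebesgue" using E by auto
  obtain b where b: "\<And>p. p \<in> K \<Longrightarrow> norm p \<le> b"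
    using compact_imp_bounded[OF K(1)] unfolding bounded_iff by auto
  obtain c where c: "\<And>p. p \<in> K\<^sub>0 \<Longrightarrow> norm p \<le> c"
    using compact_imp_bounded[OF K0(1)] unfolding bounded_iff by auto
  have "norm (closest_point K x - closest_point K\<^sub>0 x) \<le> b + c" for x
    using b[OF closest_point_in_set[OF compact_imp_closed[OF K(1)] K(2)], of x]
      c[OF closest_point_in_set[OF compact_imp_closed[OF K0(1)] K0(2)], of x]
    by (intro order_trans[OF norm_triangle_ineq4] add_mono) 
  then have le: "norm (closest_point K x - closest_point K\<^sub>0 x) \<le> \<bar>b + c\<bar>" for x
    by (rule order_trans[OF _ abs_ge_self])
  have "integrable lebesgue (\<lambda>x. indicator E x * (b + c))"
    using E by (simp add: integrable_on_indicator fmeasurable_def)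
  then show ?thesis
    unfolding set_integrable_def
  proof (elim Bochner_Integration.integrable_bound)
    show "(\<lambda>x. indicator E x *\<^sub>R norm (closest_point K x - closest_point K\<^sub>0 x)) \<in> borel_measurable lebesgue"
      by measurable
  qed (use le in \<open>auto simp: indicator_def intro!: AE_I2\<close>)
qed

text \<open>The point for \<open>K\<close> lies below a forward difference of its own potential, the
  negated point for \<open>K\<^sub>0\<close> below a backward difference of the other one.
  Exchanging the potential of \<open>K\<^sub>0\<close> for that of \<open>K\<close> at
  \<open>x\<close> and at \<open>x - y\<close> costs \<open>(M + H + \<rho>) * \<epsilon>\<close>
  each time and leaves a second difference.\<close>

lemma closest_point_diff_inner_le:
  fixes K :: "'a::euclidean_space set"
  assumes K: "closed K" "K \<noteq> {}" "K \<subseteq> cball 0 \<rho>"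
    and K0: "closed K\<^sub>0" "K\<^sub>0 \<noteq> {}" "K\<^sub>0 \<subseteq> cball 0 \<rho>"
    and sub: "K \<subseteq> parallel_set K\<^sub>0 \<epsilon>" "K\<^sub>0 \<subseteq> parallel_set K \<epsilon>"
    and "0 \<le> \<epsilon>" "norm x \<le> M" "norm y \<le> H"
  shows "(closest_point K x - closest_point K\<^sub>0 x) \<bullet> y \<le>
    second_difference (potential K) y x + 2 * (M + H + \<rho>) * \<epsilon>"
proof -
  define c where "c = (M + H + \<rho>) * \<epsilon>"
  have "potential K x - potential K\<^sub>0 x \<le> c"
    unfolding c_def using order_trans[OF norm_ge_zero \<open>norm y \<le> H\<close>] assms(9-10)
    by (intro order_trans[OF potential_le_of_subset_parallel[OF K K0 sub(1)]] mult_right_mono) auto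
  moreover have "potential K\<^sub>0 (x - y) - potential K (x - y) \<le> c"
    unfolding c_def using norm_triangle_ineq4[of x y] assms(9-11)
    by (intro order_trans[OF potential_le_of_subset_parallel[OF K0 K sub(2)]] mult_right_mono) auto
  moreover have "2 * (M + H + \<rho>) * \<epsilon> = 2 * c"
    by (simp add: c_def)
  ultimately show ?thesis
    using potential_subgradient[OF K(1,2), of x y] potential_subgradient[OF K0(1,2), of x "- y"]
    by (simp add: second_difference_def inner_diff_left)
qed

lemma integral_closest_point_diff_le:
  fixes K :: "'a::euclidean_space set"
  assumes K: "closed K" "K \<noteq> {}" "K \<subseteq> cball 0 \<rho>"
    and K0: "closed K\<^sub>0" "K\<^sub>0 \<noteq> {}" "K\<^sub>0 \<subseteq> cball 0 \<rho>"
    and sub: "K \<subseteq> parallel_set K\<^sub>0 \<epsilon>" "K\<^sub>0 \<subseteq> parallel_set K \<epsilon>"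
    and \<epsilon>: "0 < \<epsilon>" "sqrt \<epsilon> \<le> H" and "0 \<le> \<rho>" "0 \<le> M"
  shows "(LINT x:cball 0 M|lebesgue. norm (closest_point K x - closest_point K\<^sub>0 x))
    \<le> real DIM('a) * (2 * M + 2 * H + 4 * \<rho>) * measure lborel (cball (0::'a) (M + 1 + H)) * sqrt \<epsilon>"
proof -
  \<comment> \<open>After division by \<open>h\<close>, the second differences contribute order
    \<open>h\<close> and the exchange of potentials order \<open>\<epsilon> / h\<close>; this choice
    balances the two.\<close>
  define h where "h = sqrt \<epsilon>"
  have h: "0 < h" "\<epsilon> = h * h" "h \<le> H" using \<epsilon> by (auto simp: h_def)
  let ?E = "cball (0::'a) M"
  define V where "V = measure lborel (cball (0::'a) (M + 1 + H))"
  define c where "c = 2 * (M + H + \<rho>) * \<epsilon>"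
  have c0: "0 \<le> c" using h assms by (auto simp: c_def)
  let ?p = "closest_point K" and ?q = "closest_point K\<^sub>0"
  let ?D = "\<lambda>K e. second_difference (potential K) (h *\<^sub>R e)"
  \<comment> \<open>One sign of a coordinate is controlled by the second difference for
    \<open>K\<close>, the other by the one for \<open>K\<^sub>0\<close>. Both are nonnegative, so
    their sum controls the absolute value.\<close>
  define g where "g x = (\<Sum>e\<in>Basis. (?D K e x + ?D K\<^sub>0 e x + c) / h)" for x
  have ne: "norm (h *\<^sub>R e) = h" if "e \<in> Basis" for e :: 'a
    using that h by simp
  have bound: "norm (?p x - ?q x) \<le> g x" if "x \<in> ?E" for x
    unfolding g_def
  proof (rule order_trans[OF norm_le_l1 sum_mono])
    fix e :: 'a assume e: "e \<in> Basis"
    have nx: "norm x \<le> M" using that by simp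
    have nh: "norm (h *\<^sub>R e) \<le> H" using ne[OF e] h by simp
    have "\<bar>(?p x - ?q x) \<bullet> (h *\<^sub>R e)\<bar> \<le> ?D K e x + ?D K\<^sub>0 e x + c"
      using closest_point_diff_inner_le[OF K K0 sub less_imp_le[OF \<epsilon>(1)] nx nh, folded c_def]
        closest_point_diff_inner_le[OF K0 K sub(2,1) less_imp_le[OF \<epsilon>(1)] nx nh, folded c_def]
        second_difference_potential_nonneg[OF K(1,2), of "h *\<^sub>R e" x]
        second_difference_potential_nonneg[OF K0(1,2), of "h *\<^sub>R e" x]
      using c0 by (simp add: inner_diff_left right_diff_distrib abs_le_iff)
    then show "\<bar>(?p x - ?q x) \<bullet> e\<bar> \<le> (?D K e x + ?D K\<^sub>0 e x + c) / h"
      using h by (simp add: abs_mult field_simps)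
  qed
  have i: "set_integrable lborel ?E (?D K e)" "set_integrable lborel ?E (?D K\<^sub>0 e)"
    if "e \<in> Basis" for e
    using integral_second_difference_le(1)[OF K \<open>0 \<le> \<rho>\<close> order_refl]
      integral_second_difference_le(1)[OF K0 \<open>0 \<le> \<rho>\<close> order_refl] by auto
  have l: "(LINT x:?E|lborel. ?D K e x) \<le> \<rho> * h\<^sup>2 * V" "(LINT x:?E|lborel. ?D K\<^sub>0 e x) \<le> \<rho> * h\<^sup>2 * V"
    if "e \<in> Basis" for e
    using integral_second_difference_le(2)[OF K \<open>0 \<le> \<rho>\<close>, of "h *\<^sub>R e" H M]
      integral_second_difference_le(2)[OF K0 \<open>0 \<le> \<rho>\<close>, of "h *\<^sub>R e" H M] ne[OF that] h
    unfolding V_def by auto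
  have ic: "set_integrable lborel ?E (\<lambda>_. c)"
    unfolding set_integrable_def by (intro borel_integrable_compact) auto
  have ie: "set_integrable lborel ?E (\<lambda>x. (?D K e x + ?D K\<^sub>0 e x + c) / h)" if "e \<in> Basis" for e
    using i[OF that] ic by (intro set_integrable_divide set_integral_add) auto
  have ig: "set_integrable lborel ?E g"
    using ie unfolding set_integrable_def g_def scaleR_sum_right
    by (intro Bochner_Integration.integrable_sum)
  have "measure lborel ?E \<le> V"
    unfolding V_def using h by (intro measure_mono_fmeasurable) (auto simp: fmeasurable_def emeasure_lborel_cball_finite[unfolded infinity_ennreal_def])
  then have lc: "(LINT x:?E|lborel. c) \<le> c * V"
    using mult_left_mono[OF _ c0] by (simp add: set_lebesgue_integral_def mult.commute[of _ c])
  have "(LINT x:?E|lebesgue. norm (?p x - ?q x)) \<le> (LINT x:?E|lebesgue. g x)"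
    unfolding set_lebesgue_integral_def
  proof (rule integral_mono')
    show "integrable lebesgue (\<lambda>x. indicator ?E x *\<^sub>R g x)"
      using ig unfolding set_integrable_def by (intro integrable_completion[THEN iffD2]) auto
  qed (auto simp: indicator_def intro: bound order_trans[OF norm_ge_zero bound])
  also have "\<dots> = (LINT x:?E|lborel. g x)"
    unfolding set_lebesgue_integral_def
    using ig unfolding set_integrable_def by (intro integral_completion) auto
  also have "\<dots> = (\<Sum>e\<in>Basis. ((LINT x:?E|lborel. ?D K e x) + (LINT x:?E|lborel. ?D K\<^sub>0 e x) + (LINT x:?E|lborel. c)) / h)"
  proof -
    have "(LINT x:?E|lborel. g x) = (\<Sum>e\<in>Basis. LINT x:?E|lborel. (?D K e x + ?D K\<^sub>0 e x + c) / h)"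
      using ie unfolding set_lebesgue_integral_def set_integrable_def g_def scaleR_sum_right
      by (intro Bochner_Integration.integral_sum)
    also have "\<dots> = (\<Sum>e\<in>Basis. ((LINT x:?E|lborel. ?D K e x) + (LINT x:?E|lborel. ?D K\<^sub>0 e x) + (LINT x:?E|lborel. c)) / h)"
    proof (intro sum.cong refl)
      fix e :: 'a assume "e \<in> Basis"
      note i = i[OF this]
      show "(LINT x:?E|lborel. (?D K e x + ?D K\<^sub>0 e x + c) / h) =
          ((LINT x:?E|lborel. ?D K e x) + (LINT x:?E|lborel. ?D K\<^sub>0 e x) + (LINT x:?E|lborel. c)) / h"
        unfolding set_integral_divide_zero set_integral_add(2)[OF set_integral_add(1)[OF i] ic]
          set_integral_add(2)[OF i] ..
    qed
    finally show ?thesis .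
  qed
  also have "\<dots> \<le> (\<Sum>e\<in>(Basis::'a set). (\<rho> * h\<^sup>2 * V + \<rho> * h\<^sup>2 * V + c * V) / h)"
    using h by (intro sum_mono divide_right_mono add_mono l lc) auto
  \<comment> \<open>The two second differences contribute \<open>2 * \<rho>\<close> and
    \<open>c\<close> contributes \<open>2 * (M + H + \<rho>)\<close>.\<close>
  also have "\<dots> = real DIM('a) * (2 * M + 2 * H + 4 * \<rho>) * V * h"
    using h(1) by (simp add: c_def h(2) power2_eq_square field_simps)
  finally show ?thesis unfolding V_def h_def .
qed

section \<open>Volume of parallel shells\<close>

lemma closed_parallel_set: "closed (parallel_set K R)"
  unfolding parallel_set_def by (intro closed_Collect_le continuous_intros)

lemma parallel_set_subset_cball:
  fixes K :: "'a::euclidean_space set"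
  assumes "closed K" "K \<noteq> {}" "K \<subseteq> cball 0 \<rho>"
  shows "parallel_set K R \<subseteq> cball 0 (\<rho> + R)"
proof
  fix x assume "x \<in> parallel_set K R"
  then have "dist x (closest_point K x) \<le> R"
    using infdist_closest_point[OF assms(1,2)] by (simp add: parallel_set_def)
  then show "x \<in> cball 0 (\<rho> + R)"
    using closest_point_in_set[OF assms(1,2), of x] assms(3) norm_triangle_sub[of x "closest_point K x"]
    by (auto simp: dist_norm)
qed

lemma parallel_set_lmeasurable:
  fixes K :: "'a::euclidean_space set"
  assumes "closed K" "K \<noteq> {}" "K \<subseteq> cball 0 \<rho>"
  shows "parallel_set K R \<in> lmeasurable"
  using closed_parallel_set bounded_subset[OF bounded_cball parallel_set_subset_cball[OF assms]]
  by (intro lmeasurable_compact) (auto simp: compact_eq_bounded_closed)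

text \<open>A contraction by the factor \<open>t\<close> maps the larger parallel set into the
  smaller one, so the latter has at least \<open>t ^ DIM('a)\<close> times the volume of the former;
  Bernoulli's inequality makes the loss linear in \<delta>.\<close>

lemma measure_parallel_shell_small_diameter:
  fixes L :: "'a::euclidean_space set"
  assumes L: "closed L" "L \<noteq> {}" "L \<subseteq> cball 0 \<rho>"
    and diam: "\<And>x y. x \<in> L \<Longrightarrow> y \<in> L \<Longrightarrow> dist x y \<le> R / 2"
    and "0 < R" "0 \<le> \<delta>"
  shows "measure lebesgue (parallel_set L R - parallel_set L (R - \<delta>))
    \<le> real DIM('a) * (2 * \<delta> / R) * measure lebesgue (cball (0::'a) (\<rho> + R))"
proof -
  let ?P = "parallel_set L R" and ?Q = "parallel_set L (R - \<delta>)"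
  define V where "V = measure lebesgue (cball (0::'a) (\<rho> + R))"
  \<comment> \<open>The solution of \<open>t * R + (1 - t) * (R / 2) = R - \<delta>\<close>.\<close>
  define t where "t = 1 - 2 * \<delta> / R"
  have lm: "?P \<in> lmeasurable" "?Q \<in> lmeasurable"
    by (intro parallel_set_lmeasurable[OF L])+
  have PV: "measure lebesgue ?P \<le> V"
    unfolding V_def using lm parallel_set_subset_cball[OF L, of R]
    by (intro measure_mono_fmeasurable) auto
  have V0: "0 \<le> V" by (simp add: V_def)
  have sub: "?Q \<subseteq> ?P" using \<open>0 \<le> \<delta>\<close> by (auto simp: parallel_set_def)
  have diff: "measure lebesgue (?P - ?Q) = measure lebesgue ?P - measure lebesgue ?Q"
    using lm sub by (intro measurable_measure_Diff) auto
  show ?thesis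
  proof (cases "0 < t")
    \<comment> \<open>For large \<delta> the map is no contraction with positive factor, but then
      the claimed bound is at least \<open>V\<close>, which bounds the whole parallel set.\<close>
    case False
    then have "1 \<le> 2 * \<delta> / R" by (simp add: t_def)
    then have "1 \<le> real DIM('a) * (2 * \<delta> / R)"
      using DIM_positive[where 'a='a] mult_mono[of 1 "real DIM('a)" 1 "2 * \<delta> / R"] by simp
    then have "1 * V \<le> real DIM('a) * (2 * \<delta> / R) * V"
      using V0 by (intro mult_right_mono) auto
    then show ?thesis
      using diff PV measure_nonneg[of lebesgue ?Q] unfolding V_def[symmetric] by linarith
  next
    case True
    obtain z where z: "z \<in> L" using L by auto
    have t1: "0 \<le> 1 - t" using \<open>0 < R\<close> \<open>0 \<le> \<delta>\<close> by (simp add: t_def)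
    have "(\<lambda>x. t *\<^sub>R x + (1 - t) *\<^sub>R z) ` ?P \<subseteq> ?Q"
    proof safe
      fix x assume x: "x \<in> ?P"
      define q where "q = closest_point L x"
      have q: "q \<in> L" using closest_point_in_set[OF L(1,2)] by (simp add: q_def)
      \<comment> \<open>The moved point is compared with \<open>q\<close>, the point of
        \<open>L\<close> closest to \<open>x\<close>: \<open>x\<close> is within \<open>R\<close> of
        it and the center \<open>z\<close> within \<open>R / 2\<close>.\<close>
      have xq: "norm (x - q) \<le> R"
        using x infdist_closest_point[OF L(1,2), of x] by (simp add: parallel_set_def q_def dist_norm)
      have "dist (t *\<^sub>R x + (1 - t) *\<^sub>R z) q = norm (t *\<^sub>R (x - q) + (1 - t) *\<^sub>R (z - q))"
        by (simp add: dist_norm algebra_simps)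
      also have "\<dots> \<le> t * norm (x - q) + (1 - t) * norm (z - q)"
        using norm_triangle_ineq[of "t *\<^sub>R (x - q)" "(1 - t) *\<^sub>R (z - q)"] True t1 by simp
      also have "\<dots> \<le> t * R + (1 - t) * (R / 2)"
        using diam[OF z q] xq True t1 by (intro add_mono mult_left_mono) (auto simp: dist_norm)
      also have "\<dots> = R - \<delta>"
        using \<open>0 < R\<close> by (simp add: t_def field_simps)
      finally show "t *\<^sub>R x + (1 - t) *\<^sub>R z \<in> ?Q"
        unfolding parallel_set_def using q by (auto intro: infdist_le2)
    qed
    moreover have "(\<lambda>x. t *\<^sub>R x + (1 - t) *\<^sub>R z) ` ?P \<in> sets lebesgue"
      using lm closed_parallel_set[of L R]
        bounded_subset[OF bounded_cball parallel_set_subset_cball[OF L, of R]]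
      by (intro fmeasurableD lmeasurable_compact compact_continuous_image continuous_intros)
         (auto simp: compact_eq_bounded_closed)
    ultimately have "measure lebesgue ((\<lambda>x. t *\<^sub>R x + (1 - t) *\<^sub>R z) ` ?P) \<le> measure lebesgue ?Q"
      using lm by (intro measure_mono_fmeasurable)
    then have Q: "t ^ DIM('a) * measure lebesgue ?P \<le> measure lebesgue ?Q"
      unfolding measure_lebesgue_affine using True by simp
    have "1 + real DIM('a) * (t - 1) \<le> t ^ DIM('a)"
      using Bernoulli_inequality[of "t - 1" "DIM('a)"] True by simp
    then have "(1 - t ^ DIM('a)) * measure lebesgue ?P \<le> (real DIM('a) * (1 - t)) * V"
      using PV t1 by (intro mult_mono) (auto simp: algebra_simps)
    then show ?thesis
      using Q diff unfolding V_def[symmetric] by (simp add: t_def algebra_simps)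
  qed
qed

text \<open>The number of pieces of small diameter into which \<open>K\<close> is cut does not depend on \<open>K\<close>.\<close>

lemma measure_parallel_shell:
  fixes R \<rho> :: real
  assumes "0 < R"
  obtains C where "0 \<le> C"
    and "\<And>(K::'a::euclidean_space set) \<delta>. closed K \<Longrightarrow> K \<noteq> {} \<Longrightarrow> K \<subseteq> cball 0 \<rho> \<Longrightarrow> 0 \<le> \<delta> \<Longrightarrow>
      measure lebesgue (parallel_set K R - parallel_set K (R - \<delta>)) \<le> C * \<delta>"
proof -
  obtain Z :: "'a set" where Z: "finite Z" "cball 0 \<rho> \<subseteq> (\<Union>z\<in>Z. ball z (R / 4))"
    using compactE_image[OF compact_cball, of "cball (0::'a) \<rho>" "\<lambda>z. ball z (R / 4)" 0 \<rho>] assms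
    by (metis (no_types, lifting) UN_iff centre_in_ball divide_pos_pos open_ball subsetI zero_less_numeral)
  define V where "V = measure lebesgue (cball (0::'a) (\<rho> + R))"
  define C where "C = real (card Z) * (real DIM('a) * (2 / R) * V)"
  have C0: "0 \<le> C" using assms by (simp add: C_def V_def)
  have "measure lebesgue (parallel_set K R - parallel_set K (R - \<delta>)) \<le> C * \<delta>"
    if K: "closed K" "K \<noteq> {}" "K \<subseteq> cball 0 \<rho>" and \<delta>: "0 \<le> \<delta>" for K :: "'a set" and \<delta>
  proof -
    \<comment> \<open>Radius \<open>R / 4\<close> gives pieces of diameter at most
      \<open>R / 2\<close>; \<open>Y\<close> keeps the nonempty ones.\<close>
    define L where "L z = K \<inter> cball z (R / 4)" for z
    define Y where "Y = {z \<in> Z. L z \<noteq> {}}"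
    let ?S = "\<lambda>K. parallel_set K R - parallel_set K (R - \<delta>)"
    have L: "closed (L z)" "L z \<subseteq> cball 0 \<rho>" for z
      using K by (auto simp: L_def)
    have Y: "finite Y" "card Y \<le> card Z"
      using Z by (auto simp: Y_def intro: card_mono)
    have meas: "?S (L z) \<in> lmeasurable" if "z \<in> Y" for z
      using that L[of z] by (intro fmeasurable.Diff parallel_set_lmeasurable[of _ \<rho>]) (auto simp: Y_def)
    \<comment> \<open>A piece containing the point of \<open>K\<close> closest to \<open>x\<close>
      is still within \<open>R\<close> of \<open>x\<close>, and no piece is nearer to
      \<open>x\<close> than \<open>K\<close> itself.\<close>
    have "?S K \<subseteq> (\<Union>z\<in>Y. ?S (L z))"
    proof
      fix x assume x: "x \<in> ?S K"
      let ?q = "closest_point K x"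
      have q: "?q \<in> K" using closest_point_in_set[OF K(1,2)] .
      then obtain z where z: "z \<in> Z" "?q \<in> ball z (R / 4)" using Z K by blast
      then have qL: "?q \<in> L z" using q by (auto simp: L_def)
      then have "infdist x (L z) \<le> R"
        using x infdist_closest_point[OF K(1,2), of x] by (auto simp: parallel_set_def intro: infdist_le2)
      moreover have "infdist x K \<le> infdist x (L z)"
        using qL by (intro infdist_mono) (auto simp: L_def)
      ultimately show "x \<in> (\<Union>z\<in>Y. ?S (L z))"
        using x z qL by (auto simp: parallel_set_def Y_def)
    qed
    moreover have "?S K \<in> sets lebesgue"
      using closed_parallel_set[of K] by (intro sets.Diff) (auto simp: borel_closed)
    moreover have "(\<Union>z\<in>Y. ?S (L z)) \<in> lmeasurable"
      by (rule fmeasurable.finite_UN[OF Y(1) meas])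
    ultimately have "measure lebesgue (?S K) \<le> measure lebesgue (\<Union>z\<in>Y. ?S (L z))"
      by (rule measure_mono_fmeasurable)
    also have "\<dots> \<le> (\<Sum>z\<in>Y. measure lebesgue (?S (L z)))"
      using Y meas by (intro measure_UNION_le) auto
    also have "\<dots> \<le> (\<Sum>z\<in>Y. real DIM('a) * (2 * \<delta> / R) * V)"
    proof (rule sum_mono)
      fix z assume "z \<in> Y"
      moreover have "dist x y \<le> R / 2" if "x \<in> L z" "y \<in> L z" for x y
        using that dist_triangle3[of x y z] by (auto simp: L_def)
      ultimately show "measure lebesgue (?S (L z)) \<le> real DIM('a) * (2 * \<delta> / R) * V"
        unfolding V_def using L assms \<delta> by (intro measure_parallel_shell_small_diameter) (auto simp: Y_def)
    qed
    also have "\<dots> \<le> real (card Z) * (real DIM('a) * (2 * \<delta> / R) * V)"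
      unfolding sum_constant using Y assms \<delta> by (intro mult_right_mono) (auto simp: V_def)
    also have "\<dots> = C * \<delta>" by (simp add: C_def)
    finally show ?thesis .
  qed
  then show ?thesis by (rule that[OF C0])
qed

lemma infdist_le_of_subset_parallel:
  fixes K :: "'a::euclidean_space set"
  assumes "closed K" "K \<noteq> {}" "K \<subseteq> parallel_set K\<^sub>0 \<epsilon>"
  shows "infdist x K\<^sub>0 \<le> infdist x K + \<epsilon>"
proof -
  have "closest_point K x \<in> parallel_set K\<^sub>0 \<epsilon>"
    using closest_point_in_set[OF assms(1,2)] assms(3) by auto
  then show ?thesis
    using infdist_triangle[of x K\<^sub>0 "closest_point K x"] infdist_closest_point[OF assms(1,2), of x]
    by (simp add: parallel_set_def)
qed

text \<open>This reduces each half of the symmetric difference to a shell of a single set, to which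
  the volume bound applies.\<close>

lemma parallel_set_diff_subset_shell:
  fixes K :: "'a::euclidean_space set"
  assumes "closed K" "K \<noteq> {}" "K \<subseteq> parallel_set K\<^sub>0 \<epsilon>"
  shows "parallel_set K R - parallel_set K\<^sub>0 R \<subseteq> parallel_set K R - parallel_set K (R - \<epsilon>)"
proof safe
  fix x assume "x \<notin> parallel_set K\<^sub>0 R" "x \<in> parallel_set K (R - \<epsilon>)"
  then show False
    using infdist_le_of_subset_parallel[OF assms, of x] by (simp add: parallel_set_def)
qed

section \<open>Tensors and the bounded Lipschitz distance\<close>

lemma abs_prod_le_power_card:
  fixes z :: "'i \<Rightarrow> real"
  assumes "\<And>i. i \<in> I \<Longrightarrow> \<bar>z i\<bar> \<le> B"
  shows "\<bar>\<Prod>i\<in>I. z i\<bar> \<le> B ^ card I"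
  using prod_mono[of I "\<lambda>i. \<bar>z i\<bar>" "\<lambda>_. B"] assms by (simp add: abs_prod)

text \<open>Division by \<open>B\<close> brings all factors into the unit interval in absolute
  value, where differences of products are bounded by sums of differences; scaling back costs
  \<open>B ^ card I\<close>.\<close>

lemma abs_prod_diff_le:
  fixes z w :: "'i \<Rightarrow> real"
  assumes "1 \<le> B" and "\<And>i. i \<in> I \<Longrightarrow> \<bar>z i\<bar> \<le> B" and "\<And>i. i \<in> I \<Longrightarrow> \<bar>w i\<bar> \<le> B"
  shows "\<bar>(\<Prod>i\<in>I. z i) - (\<Prod>i\<in>I. w i)\<bar> \<le> B ^ card I * (\<Sum>i\<in>I. \<bar>z i - w i\<bar>)"
proof -
  have "norm ((\<Prod>i\<in>I. z i / B) - (\<Prod>i\<in>I. w i / B)) \<le> (\<Sum>i\<in>I. norm (z i / B - w i / B))"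
    using assms by (intro norm_prod_diff) (auto simp: abs_divide)
  also have "\<dots> \<le> (\<Sum>i\<in>I. \<bar>z i - w i\<bar>)"
    using assms(1)
    by (intro sum_mono) (auto simp: diff_divide_distrib[symmetric] abs_divide divide_le_eq_1
      intro!: divide_le_eq[THEN iffD2] mult_left_mono[of 1 B, simplified])
  finally have "\<bar>((\<Prod>i\<in>I. z i) - (\<Prod>i\<in>I. w i)) / B ^ card I\<bar> \<le> (\<Sum>i\<in>I. \<bar>z i - w i\<bar>)"
    by (simp add: prod_dividef diff_divide_distrib)
  then show ?thesis
    using assms(1) by (simp add: abs_divide divide_le_eq mult.commute)
qed

text \<open>Merging the two powers into one product over \<open>r + s\<close> factors lets estimates
  for products be applied to each permutation separately.\<close>

lemma sym_power_prod_eq: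
  "sym_power_prod a r b s v =
    1 / fact (r + s) * (\<Sum>\<sigma> | \<sigma> permutes {..<r + s}. \<Prod>i<r + s. (if i < r then a else b) \<bullet> v (\<sigma> i))"
proof -
  have "(\<Prod>i<r. a \<bullet> v (\<sigma> i)) * (\<Prod>i<s. b \<bullet> v (\<sigma> (r + i))) =
      (\<Prod>i<r + s. (if i < r then a else b) \<bullet> v (\<sigma> i))" for \<sigma>
  proof -
    have "(\<Prod>i<r + s. (if i < r then a else b) \<bullet> v (\<sigma> i)) =
      (\<Prod>i<r. (if i < r then a else b) \<bullet> v (\<sigma> i)) *
      (\<Prod>i=r..<r + s. (if i < r then a else b) \<bullet> v (\<sigma> i))"
      using prod.atLeastLessThan_concat[of 0 r "r + s" "\<lambda>i. (if i < r then a else b) \<bullet> v (\<sigma> i)"]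
      by (simp add: atLeast0LessThan)
    also have "(\<Prod>i=r..<r + s. (if i < r then a else b) \<bullet> v (\<sigma> i)) = (\<Prod>i<s. b \<bullet> v (\<sigma> (r + i)))"
      using prod.shift_bounds_nat_ivl[of "\<lambda>i. b \<bullet> v (\<sigma> i)" 0 r s]
      by (simp add: atLeast0LessThan add.commute)
    finally show ?thesis by simp
  qed
  then show ?thesis
    by (simp add: sym_power_prod_def symmetrization_def tensor_prod_def tensor_power_def)
qed

lemma abs_average_permutations_le:
  fixes F :: "(nat \<Rightarrow> nat) \<Rightarrow> real"
  assumes "\<And>\<sigma>. \<sigma> permutes {..<n} \<Longrightarrow> \<bar>F \<sigma>\<bar> \<le> c"
  shows "\<bar>1 / fact n * (\<Sum>\<sigma> | \<sigma> permutes {..<n}. F \<sigma>)\<bar> \<le> c"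
proof -
  have "\<bar>\<Sum>\<sigma> | \<sigma> permutes {..<n}. F \<sigma>\<bar> \<le> (\<Sum>\<sigma> | \<sigma> permutes {..<n}. \<bar>F \<sigma>\<bar>)"
    by (rule sum_abs)
  also have "\<dots> \<le> (\<Sum>\<sigma> | \<sigma> permutes {..<n}. c)"
    using assms by (intro sum_mono) auto
  also have "\<dots> = fact n * c"
    by (simp add: card_permutations)
  finally show ?thesis
    by (simp add: abs_mult divide_le_eq mult.commute)
qed

lemma abs_inner_unit_le:
  fixes a u :: "'a::euclidean_space"
  assumes "norm u = 1"
  shows "\<bar>a \<bullet> u\<bar> \<le> norm a"
  using Cauchy_Schwarz_ineq2[of a u] assms by simp

lemma abs_sym_power_prod_le:
  fixes a b :: "'a::euclidean_space"
  assumes v: "\<forall>i<r + s. norm (v i) = 1" and "norm a \<le> B" "norm b \<le> B"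
  shows "\<bar>sym_power_prod a r b s v\<bar> \<le> B ^ (r + s)"
  unfolding sym_power_prod_eq
proof (rule abs_average_permutations_le)
  fix \<sigma> assume \<sigma>: "\<sigma> permutes {..<r + s}"
  have "\<bar>(if i < r then a else b) \<bullet> v (\<sigma> i)\<bar> \<le> B" if "i \<in> {..<r + s}" for i
    using v assms permutes_in_image[OF \<sigma>, of i] that
    by (intro order_trans[OF abs_inner_unit_le]) auto
  then show "\<bar>\<Prod>i<r + s. (if i < r then a else b) \<bullet> v (\<sigma> i)\<bar> \<le> B ^ (r + s)"
    using abs_prod_le_power_card[of "{..<r + s}"] by fastforce
qed

lemma abs_sym_power_prod_diff_le:
  fixes a b a' b' :: "'a::euclidean_space"
  assumes v: "\<forall>i<r + s. norm (v i) = 1" and "1 \<le> B"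
    and "norm a \<le> B" "norm b \<le> B" "norm a' \<le> B" "norm b' \<le> B"
    and d: "norm (a - a') \<le> \<eta>" "norm (b - b') \<le> \<eta>"
  shows "\<bar>sym_power_prod a r b s v - sym_power_prod a' r b' s v\<bar> \<le> B ^ (r + s) * (real (r + s) * \<eta>)"
  unfolding sym_power_prod_eq right_diff_distrib[symmetric] sum_subtractf[symmetric]
proof (rule abs_average_permutations_le)
  fix \<sigma> assume \<sigma>: "\<sigma> permutes {..<r + s}"
  let ?z = "\<lambda>i. (if i < r then a else b) \<bullet> v (\<sigma> i)" and ?w = "\<lambda>i. (if i < r then a' else b') \<bullet> v (\<sigma> i)"
  have n: "norm (v (\<sigma> i)) = 1" if "i \<in> {..<r + s}" for i
    using v permutes_in_image[OF \<sigma>, of i] that by auto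
  have "\<bar>(\<Prod>i<r + s. ?z i) - (\<Prod>i<r + s. ?w i)\<bar> \<le> B ^ card {..<r + s} * (\<Sum>i<r + s. \<bar>?z i - ?w i\<bar>)"
    using assms n by (intro abs_prod_diff_le order_trans[OF abs_inner_unit_le]) auto
  also have "(\<Sum>i<r + s. \<bar>?z i - ?w i\<bar>) \<le> (\<Sum>i<r + s. \<eta>)"
    unfolding inner_diff_left[symmetric]
    using d n by (intro sum_mono order_trans[OF abs_inner_unit_le]) auto
  finally show "\<bar>(\<Prod>i<r + s. ?z i) - (\<Prod>i<r + s. ?w i)\<bar> \<le> B ^ (r + s) * (real (r + s) * \<eta>)"
    using \<open>1 \<le> B\<close> by simp
qed

lemma borel_measurable_sym_power_prod:
  fixes f g :: "'b \<Rightarrow> 'a::euclidean_space"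
  assumes [measurable]: "f \<in> borel_measurable M" "g \<in> borel_measurable M"
  shows "(\<lambda>x. sym_power_prod (f x) r (g x) s v) \<in> borel_measurable M"
  unfolding sym_power_prod_eq
proof (intro borel_measurable_times borel_measurable_const borel_measurable_sum borel_measurable_prod)
  fix \<sigma> :: "nat \<Rightarrow> nat" and i
  show "(\<lambda>x. (if i < r then f x else g x) \<bullet> v (\<sigma> i)) \<in> borel_measurable M"
    by (cases "i < r") simp_all
qed

text \<open>For fixed arguments \<open>v\<close>, the Voronoi tensor measure is the image under
  \<open>closest_point K\<close> of a bounded density on the parallel set, which has finite Lebesgue
  measure. Hence \<open>signed_integral_pushforward\<close> applies.\<close>

lemma tensor_integral_voronoi:
  fixes K :: "'a::euclidean_space set"
  assumes K: "compact K" "K \<noteq> {}" "K \<subseteq> cball 0 \<rho>"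
    and v: "\<forall>i<r + s. norm (v i) = 1" and f: "f \<in> borel_measurable borel" "bounded (range f)"
  shows "tensor_integral (voronoi_tensor_measure R r s K) f v =
      (LINT x:parallel_set K R|lebesgue. f (closest_point K x) *
        sym_power_prod (closest_point K x) r (x - closest_point K x) s v)"
    and "set_integrable lebesgue (parallel_set K R) (\<lambda>x. f (closest_point K x) *
        sym_power_prod (closest_point K x) r (x - closest_point K x) s v)"
proof -
  let ?P = "parallel_set K R"
  let ?p = "closest_point K"
  let ?g = "\<lambda>x. sym_power_prod (?p x) r (x - ?p x) s v"
  have cl: "closed K" using K by (auto intro: compact_imp_closed)
  note p = borel_measurable_closest_point[OF K(1,2)]
  have P: "?P \<in> lmeasurable" by (rule parallel_set_lmeasurable[OF cl K(2,3)])
  then have P': "?P \<inter> space lebesgue \<in> sets lebesgue" by auto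
  have pm: "?p \<in> borel_measurable (lebesgue_on ?P)"
    by (rule measurable_restrict_space1[OF p])
  have gm: "?g \<in> borel_measurable (lebesgue_on ?P)"
    by (intro measurable_restrict_space1 borel_measurable_sym_power_prod p borel_measurable_diff
      measurable_completion) auto
  have fin: "finite_measure (lebesgue_on ?P)"
    by (rule finite_measure_lebesgue_on[OF P])
  have "\<bar>?g x\<bar> \<le> (\<bar>\<rho>\<bar> + \<bar>R\<bar> + \<bar>\<rho>\<bar>) ^ (r + s)" if "x \<in> ?P" for x
  proof (rule abs_sym_power_prod_le[OF v])
    show "norm (?p x) \<le> \<bar>\<rho>\<bar> + \<bar>R\<bar> + \<bar>\<rho>\<bar>"
      using norm_closest_point_le[OF cl K(2,3), of x] by linarith
    show "norm (x - ?p x) \<le> \<bar>\<rho>\<bar> + \<bar>R\<bar> + \<bar>\<rho>\<bar>"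
      using that infdist_closest_point[OF cl K(2), of x] by (simp add: parallel_set_def dist_norm)
  qed
  then have gi: "integrable (lebesgue_on ?P) ?g"
    by (intro finite_measure.integrable_const_bound[OF fin AE_I2 gm]) auto
  have conv: "(LINT x:?P|lebesgue. k x) = (LINT x|lebesgue_on ?P. k x)" for k :: "'a \<Rightarrow> real"
    unfolding set_lebesgue_integral_def by (rule integral_restrict_space[OF P', symmetric])
  show "tensor_integral (voronoi_tensor_measure R r s K) f v = (LINT x:?P|lebesgue. f (?p x) * ?g x)"
    unfolding tensor_integral_def voronoi_tensor_measure_def conv
    by (rule signed_integral_pushforward[OF fin pm gi f])
  have "bounded (range (\<lambda>x. f (?p x)))"
    using f(2) by (rule bounded_subset) auto
  then have "integrable (lebesgue_on ?P) (\<lambda>x. f (?p x) * ?g x)"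
    by (rule integrable_bounded_mult[OF gi measurable_compose[OF pm f(1)]])
  then show "set_integrable lebesgue ?P (\<lambda>x. f (?p x) * ?g x)"
    unfolding set_integrable_def by (subst (asm) integrable_restrict_space[OF P'])
qed

section \<open>Handling the suprema and infima in the two distances\<close>

lemma bL_norm_le_1D:
  fixes f :: "'a::euclidean_space \<Rightarrow> real"
  assumes f: "bounded_Lipschitz f" and "bL_norm f \<le> 1"
  shows "\<bar>f x\<bar> \<le> 1" and "\<bar>f x - f y\<bar> \<le> norm (x - y)"
proof -
  obtain b where b: "\<And>x. \<bar>f x\<bar> \<le> b"
    using f by (auto simp: bounded_Lipschitz_def bounded_iff)
  obtain L where L: "L-lipschitz_on UNIV f"
    using f by (auto simp: bounded_Lipschitz_def)
  have sup: "\<bar>f x\<bar> \<le> (SUP x. \<bar>f x\<bar>)" for x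
    using b by (intro cSUP_upper bdd_aboveI[of _ b]) auto
  have quot: "\<bar>f x - f y\<bar> / norm (x - y) \<le> Lip_seminorm f" if "x \<noteq> y" for x y
  proof -
    have "\<bar>f x - f y\<bar> / norm (x - y) \<le> L" if "x \<noteq> y" for x y
      using lipschitz_onD[OF L, of x y] that by (simp add: dist_norm divide_le_eq)
    then have "bdd_above ((\<lambda>(x, y). \<bar>f x - f y\<bar> / norm (x - y)) ` {(x, y). x \<noteq> y})"
      by (intro bdd_aboveI[of _ L]) auto
    then show ?thesis
      unfolding Lip_seminorm_def using that by (intro cSUP_upper2[where x = "(x, y)"]) auto
  qed
  \<comment> \<open>The distinct points \<open>e\<close> and 0 provide a difference quotient, so the
    seminorm is nonnegative. As both summands of \<open>bL_norm f\<close> are nonnegative, each is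
    at most 1.\<close>
  obtain e :: 'a where "e \<in> Basis" using nonempty_Basis by blast
  then have "e \<noteq> 0" by auto
  then have L0: "0 \<le> Lip_seminorm f"
    by (intro order_trans[OF _ quot[of e 0]]) auto
  show "\<bar>f x\<bar> \<le> 1"
    using sup[of x] L0 \<open>bL_norm f \<le> 1\<close> by (simp add: bL_norm_def)
  have "0 \<le> (SUP x. \<bar>f x\<bar>)"
    by (rule order_trans[OF _ sup[of 0]]) simp
  then have "Lip_seminorm f \<le> 1"
    using \<open>bL_norm f \<le> 1\<close> by (simp add: bL_norm_def)
  then show "\<bar>f x - f y\<bar> \<le> norm (x - y)"
    using quot[of x y] mult_right_mono[of "Lip_seminorm f" 1 "norm (x - y)"]
    by (cases "x = y") (auto simp: divide_le_eq intro: order_trans)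
qed

lemma bL_dist_le:
  fixes \<mu> \<nu> :: "'a::euclidean_space set \<Rightarrow> 'a tensor"
  assumes "\<And>f v. f \<in> borel_measurable borel \<Longrightarrow> bounded (range f) \<Longrightarrow> (\<And>x. \<bar>f x\<bar> \<le> 1) \<Longrightarrow>
      (\<And>x y. \<bar>f x - f y\<bar> \<le> norm (x - y)) \<Longrightarrow> \<forall>i<p. norm (v i) = 1 \<Longrightarrow>
      \<bar>tensor_integral \<mu> f v - tensor_integral \<nu> f v\<bar> \<le> c"
  shows "bL_dist p \<mu> \<nu> \<le> c"
  unfolding bL_dist_def
proof (rule cSUP_least)
  obtain e :: 'a where e: "e \<in> Basis" using nonempty_Basis by blast
  \<comment> \<open>The zero function witnesses that the supremum is over a nonempty set, as
    \<open>cSUP_least\<close> requires on the reals.\<close>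
  have "bounded_Lipschitz (\<lambda>_::'a. 0)"
    by (auto simp: bounded_Lipschitz_def intro!: exI[of _ 0] lipschitz_onI)
  moreover have "Lip_seminorm (\<lambda>_::'a. 0) \<le> 0"
    unfolding Lip_seminorm_def
  proof (rule cSUP_least)
    have "(e, 0) \<in> {(x, y :: 'a). x \<noteq> y}" using nonzero_Basis[OF e] by simp
    then show "{(x, y :: 'a). x \<noteq> y} \<noteq> {}" by blast
  qed auto
  then have "bL_norm (\<lambda>_::'a. 0) \<le> 1"
    by (simp add: bL_norm_def)
  ultimately show "{f :: 'a \<Rightarrow> real. bounded_Lipschitz f \<and> bL_norm f \<le> 1} \<noteq> {}"
    by blast
  fix f :: "'a \<Rightarrow> real" assume "f \<in> {f. bounded_Lipschitz f \<and> bL_norm f \<le> 1}"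
  then have f: "bounded_Lipschitz f" "bL_norm f \<le> 1" by auto
  then have bd: "bounded (range f)" and "continuous_on UNIV f"
    by (auto simp: bounded_Lipschitz_def intro: lipschitz_on_continuous_on)
  then have m: "f \<in> borel_measurable borel"
    by (intro borel_measurable_continuous_onI)
  show "tensor_norm p (\<lambda>v. tensor_integral \<mu> f v - tensor_integral \<nu> f v) \<le> c"
    unfolding tensor_norm_def
  proof (rule cSUP_least)
    show "{v :: nat \<Rightarrow> 'a. \<forall>i<p. norm (v i) = 1} \<noteq> {}"
      using e by (auto intro!: exI[of _ "\<lambda>_. e"])
  qed (use assms[OF m bd bL_norm_le_1D[OF f]] in auto)
qed

text \<open>Passage to the infimum over all admissible \<epsilon>, which also covers distance 0.
  Since \<open>2 * \<rho>\<close> is always admissible for sets in the ball of radius \<rho>, larger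
  \<epsilon> follow from that one.\<close>

lemma le_sqrt_hausdorff_dist:
  fixes K K\<^sub>0 :: "'a::euclidean_space set"
  assumes K: "closed K" "K \<noteq> {}" "K \<subseteq> cball 0 \<rho>"
    and K0: "closed K\<^sub>0" "K\<^sub>0 \<noteq> {}" "K\<^sub>0 \<subseteq> cball 0 \<rho>" and "0 < \<rho>" "0 < C"
    and le: "\<And>\<epsilon>. 0 < \<epsilon> \<Longrightarrow> \<epsilon> \<le> 2 * \<rho> \<Longrightarrow> K \<subseteq> parallel_set K\<^sub>0 \<epsilon> \<Longrightarrow> K\<^sub>0 \<subseteq> parallel_set K \<epsilon> \<Longrightarrow>
      b \<le> C * sqrt \<epsilon>"
  shows "b \<le> C * sqrt (hausdorff_dist K K\<^sub>0)"
proof -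
  have sub: "A \<subseteq> parallel_set A' (2 * \<rho>)" if A: "A \<subseteq> cball 0 \<rho>" and A': "A' \<noteq> {}" "A' \<subseteq> cball 0 \<rho>" for A A' :: "'a set"
  proof
    fix x assume "x \<in> A"
    obtain y where "y \<in> A'" using A' by auto
    moreover from this have "norm x \<le> \<rho>" "norm y \<le> \<rho>"
      using A A'(2) \<open>x \<in> A\<close> by auto
    ultimately show "x \<in> parallel_set A' (2 * \<rho>)"
      unfolding parallel_set_def using norm_triangle_ineq4[of x y]
      by (auto simp: dist_norm intro!: infdist_le2[of y])
  qed
  let ?S = "{\<epsilon>. \<epsilon> > 0 \<and> K \<subseteq> parallel_set K\<^sub>0 \<epsilon> \<and> K\<^sub>0 \<subseteq> parallel_set K \<epsilon>}"
  have mem: "2 * \<rho> \<in> ?S" using sub K K0 \<open>0 < \<rho>\<close> by auto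
  have all: "b \<le> C * sqrt \<epsilon>" if "\<epsilon> \<in> ?S" for \<epsilon>
  proof (cases "\<epsilon> \<le> 2 * \<rho>")
    case False
    have "b \<le> C * sqrt (2 * \<rho>)" using mem by (intro le) auto
    also have "\<dots> \<le> C * sqrt \<epsilon>" using False \<open>0 < C\<close> by simp
    finally show ?thesis .
  qed (use that le in auto)
  show ?thesis
  proof (cases "0 \<le> b")
    case True
    \<comment> \<open>Squaring turns the bounds into a lower bound for the admissible \<epsilon>
      themselves, which passes to their infimum.\<close>
    have "(b / C)\<^sup>2 \<le> hausdorff_dist K K\<^sub>0"
      unfolding hausdorff_dist_def
    proof (rule cInf_greatest)
      show "?S \<noteq> {}" using mem by blast
      fix \<epsilon> assume \<epsilon>: "\<epsilon> \<in> ?S"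
      then have "b / C \<le> sqrt \<epsilon>" using all[OF \<epsilon>] \<open>0 < C\<close> by (simp add: field_simps)
      then have "(b / C)\<^sup>2 \<le> (sqrt \<epsilon>)\<^sup>2" using True \<open>0 < C\<close> by (intro power_mono) auto
      then show "(b / C)\<^sup>2 \<le> \<epsilon>" using \<epsilon> by simp
    qed
    then have "b / C \<le> sqrt (hausdorff_dist K K\<^sub>0)" by (rule real_le_rsqrt)
    then show ?thesis using \<open>0 < C\<close> by (simp add: field_simps)
  next
    case False
    have "0 \<le> hausdorff_dist K K\<^sub>0"
      unfolding hausdorff_dist_def using mem by (intro cInf_greatest) auto
    then show ?thesis using False \<open>0 < C\<close>
      by (simp add: order_trans[of b 0])
  qed
qed

section \<open>Combining the estimates\<close>

lemma tensor_integral_voronoi_diff_le: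
  fixes K K\<^sub>0 :: "'a::euclidean_space set"
  assumes K: "compact K" "K \<noteq> {}" "K \<subseteq> cball 0 \<rho>"
    and K0: "compact K\<^sub>0" "K\<^sub>0 \<noteq> {}" "K\<^sub>0 \<subseteq> cball 0 \<rho>"
    and "0 \<le> \<rho>" "0 \<le> R" and B: "1 \<le> B" "2 * \<rho> + R \<le> B"
    and v: "\<forall>i<r + s. norm (v i) = 1" and f: "f \<in> borel_measurable borel" "bounded (range f)"
    and f1: "\<And>x. \<bar>f x\<bar> \<le> 1" and fL: "\<And>x y. \<bar>f x - f y\<bar> \<le> norm (x - y)"
  shows "\<bar>tensor_integral (voronoi_tensor_measure R r s K) f v -
      tensor_integral (voronoi_tensor_measure R r s K\<^sub>0) f v\<bar> \<le>
    B ^ (r + s) * ((1 + real (r + s)) *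
        (LINT x:cball 0 (\<rho> + R)|lebesgue. norm (closest_point K x - closest_point K\<^sub>0 x)) +
      measure lebesgue (parallel_set K R - parallel_set K\<^sub>0 R) +
      measure lebesgue (parallel_set K\<^sub>0 R - parallel_set K R))"
proof -
  let ?E = "cball (0::'a) (\<rho> + R)" and ?P = "parallel_set K R" and ?Q = "parallel_set K\<^sub>0 R"
  let ?p = "closest_point K" and ?q = "closest_point K\<^sub>0"
  define T where "T x = sym_power_prod (?p x) r (x - ?p x) s v" for x
  define T0 where "T0 x = sym_power_prod (?q x) r (x - ?q x) s v" for x
  define F where "F x = f (?p x) * T x" for x
  define F0 where "F0 x = f (?q x) * T0 x" for x
  define b where "b = B ^ (r + s)"
  define n where "n = real (r + s)"
  have b0: "0 \<le> b" using B by (simp add: b_def)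
  have cl: "closed K" "closed K\<^sub>0" using K K0 by (auto intro: compact_imp_closed)
  have sub: "?P \<subseteq> ?E" "?Q \<subseteq> ?E"
    using parallel_set_subset_cball cl K K0 by blast+
  have lm: "?P \<in> lmeasurable" "?Q \<in> lmeasurable"
    using parallel_set_lmeasurable cl K K0 by blast+
  \<comment> \<open>On \<open>?E\<close> the norm of \<open>x\<close> is at most
    \<open>\<rho> + R\<close> and that of a closest point at most \<rho>, whence the requirement
    \<open>2 * \<rho> + R \<le> B\<close>.\<close>
  have nb: "norm (?p x) \<le> B" "norm (?q x) \<le> B" "norm (x - ?p x) \<le> B" "norm (x - ?q x) \<le> B"
    if "x \<in> ?E" for x
    using that norm_closest_point_le[OF cl(1) K(2,3), of x] norm_closest_point_le[OF cl(2) K0(2,3), of x]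
      norm_triangle_ineq4[of x "?p x"] norm_triangle_ineq4[of x "?q x"] B \<open>0 \<le> \<rho>\<close> \<open>0 \<le> R\<close> by auto
  have Tb: "\<bar>T x\<bar> \<le> b" "\<bar>T0 x\<bar> \<le> b" if "x \<in> ?E" for x
    unfolding T_def T0_def b_def using nb[OF that] by (intro abs_sym_power_prod_le[OF v]; simp)+
  have Fb: "\<bar>F x\<bar> \<le> b" "\<bar>F0 x\<bar> \<le> b" if "x \<in> ?E" for x
    unfolding F_def F0_def abs_mult using Tb[OF that] f1 mult_mono[of "\<bar>f y\<bar>" 1 _ b for y] by fastforce+
  have FD: "\<bar>F x - F0 x\<bar> \<le> b * (1 + n) * norm (?p x - ?q x)" if x: "x \<in> ?E" for x
  proof -
    \<comment> \<open>The first summand uses the Lipschitz bound for \<open>f\<close> and gives the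
      1 in \<open>1 + n\<close>. The second uses the bound 1 for \<open>f\<close> and gives
      \<open>n\<close>, since both tensor factors move by the same distance
      \<open>norm (?p x - ?q x)\<close>.\<close>
    have "F x - F0 x = (f (?p x) - f (?q x)) * T x + f (?q x) * (T x - T0 x)"
      by (simp add: F_def F0_def algebra_simps)
    then have "\<bar>F x - F0 x\<bar> \<le> \<bar>f (?p x) - f (?q x)\<bar> * \<bar>T x\<bar> + \<bar>f (?q x)\<bar> * \<bar>T x - T0 x\<bar>"
      by (metis abs_mult abs_triangle_ineq)
    also have "\<dots> \<le> norm (?p x - ?q x) * b + 1 * (b * (n * norm (?p x - ?q x)))"
    proof (intro add_mono mult_mono fL f1 Tb x)
      show "\<bar>T x - T0 x\<bar> \<le> b * (n * norm (?p x - ?q x))"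
        unfolding T_def T0_def b_def n_def using nb[OF x] B
        by (intro abs_sym_power_prod_diff_le[OF v]) (auto simp: norm_minus_commute)
    qed auto
    finally show ?thesis by (simp add: algebra_simps)
  qed
  \<comment> \<open>An integrable majorant: where the parallel sets overlap, the first term
    dominates the difference of the integrands; on the symmetric difference only one integrand is
    present, and it is bounded by \<open>b\<close>.\<close>
  define G where "G x = b * (1 + n) * (indicator ?E x * norm (?p x - ?q x)) +
      b * (indicator (?P - ?Q) x + indicator (?Q - ?P) x)" for x
  have iE: "integrable lebesgue (\<lambda>x. indicator ?E x * norm (?p x - ?q x))"
    using set_integrable_closest_point_diff[OF K(1,2) K0(1,2), of ?E] by (simp add: set_integrable_def)
  have iP: "integrable lebesgue (indicator (?P - ?Q) :: 'a \<Rightarrow> real)"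
      "integrable lebesgue (indicator (?Q - ?P) :: 'a \<Rightarrow> real)"
    using fmeasurable.Diff[OF lm] fmeasurable.Diff[OF lm(2,1)]
    by (auto simp: fmeasurable_def intro!: integrable_real_indicator)
  have iF: "integrable lebesgue (\<lambda>x. indicator ?P x * F x)" "integrable lebesgue (\<lambda>x. indicator ?Q x * F0 x)"
    using tensor_integral_voronoi(2)[OF K v f, of R] tensor_integral_voronoi(2)[OF K0 v f, of R]
    by (simp_all add: set_integrable_def F_def F0_def T_def T0_def)
  have "tensor_integral (voronoi_tensor_measure R r s K) f v -
      tensor_integral (voronoi_tensor_measure R r s K\<^sub>0) f v =
      (LINT x|lebesgue. indicator ?P x * F x - indicator ?Q x * F0 x)"
    using tensor_integral_voronoi(1)[OF K v f, of R] tensor_integral_voronoi(1)[OF K0 v f, of R] iF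
    by (simp add: set_lebesgue_integral_def F_def F0_def T_def T0_def)
  also have "\<bar>\<dots>\<bar> \<le> (LINT x|lebesgue. \<bar>indicator ?P x * F x - indicator ?Q x * F0 x\<bar>)"
    by (rule integral_abs_bound)
  also have "\<dots> \<le> (LINT x|lebesgue. G x)"
  proof (rule integral_mono')
    show "integrable lebesgue G"
      unfolding G_def using iE iP by (intro Bochner_Integration.integrable_add integrable_mult_right)
    fix x
    have nn: "0 \<le> b * (1 + n) * norm (?p x - ?q x)" using b0 by (simp add: n_def)
    show "\<bar>indicator ?P x * F x - indicator ?Q x * F0 x\<bar> \<le> G x"
      using sub FD[of x] Fb[of x] nn b0 unfolding G_def
      by (cases "x \<in> ?P"; cases "x \<in> ?Q"; cases "x \<in> ?E") (auto simp del: mem_cball)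
    show "0 \<le> G x" using b0 by (simp add: G_def n_def)
  qed
  also have "\<dots> = b * (1 + n) * (LINT x|lebesgue. indicator ?E x * norm (?p x - ?q x)) +
      b * (measure lebesgue (?P - ?Q) + measure lebesgue (?Q - ?P))"
    unfolding G_def using iE iP by simp
  finally show ?thesis
    by (simp add: set_lebesgue_integral_def b_def n_def algebra_simps)
qed

theorem theorem4p1:
  fixes R \<rho> :: real and r s :: nat
  assumes "R > 0" and "\<rho> > 0"
  shows "\<exists>C>0. \<forall>K K\<^sub>0 :: 'a::euclidean_space set.
    K \<noteq> {} \<and> compact K \<and> K \<subseteq> cball 0 \<rho> \<and>
    K\<^sub>0 \<noteq> {} \<and> compact K\<^sub>0 \<and> K\<^sub>0 \<subseteq> cball 0 \<rho> \<longrightarrow>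
    bL_dist (r + s) (voronoi_tensor_measure R r s K) (voronoi_tensor_measure R r s K\<^sub>0)
      \<le> C * sqrt (hausdorff_dist K K\<^sub>0)"
proof -
  obtain c where c: "0 \<le> c"
    and shell: "\<And>(K::'a set) \<delta>. closed K \<Longrightarrow> K \<noteq> {} \<Longrightarrow> K \<subseteq> cball 0 \<rho> \<Longrightarrow> 0 \<le> \<delta> \<Longrightarrow>
      measure lebesgue (parallel_set K R - parallel_set K (R - \<delta>)) \<le> c * \<delta>"
    using measure_parallel_shell[OF \<open>R > 0\<close>] by blast
  \<comment> \<open>An upper bound for the step \<open>sqrt \<epsilon>\<close>, as only
    \<open>\<epsilon> \<le> 2 * \<rho>\<close> has to be considered.\<close>
  define H where "H = sqrt (2 * \<rho>)"
  define B where "B = 1 + 2 * \<rho> + R"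
  define A where "A = real DIM('a) * (2 * (\<rho> + R) + 2 * H + 4 * \<rho>) *
    measure lborel (cball (0::'a) (\<rho> + R + 1 + H))"
  \<comment> \<open>The term with \<open>A\<close> comes from the closest point maps,
    \<open>2 * (c * H)\<close> from the two shells; the final 1 ensures positivity.\<close>
  define C where "C = B ^ (r + s) * ((1 + real (r + s)) * A + 2 * (c * H)) + 1"
  have pos: "0 < H" "1 \<le> B" "2 * \<rho> + R \<le> B" using assms by (auto simp: H_def B_def)
  then have "0 \<le> A" using assms by (simp add: A_def)
  then have C: "0 < C" using pos c by (simp add: C_def add_nonneg_pos)
  have "bL_dist (r + s) (voronoi_tensor_measure R r s K) (voronoi_tensor_measure R r s K\<^sub>0)
      \<le> C * sqrt (hausdorff_dist K K\<^sub>0)"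
    if K: "K \<noteq> {}" "compact K" "K \<subseteq> cball 0 \<rho>" and K0: "K\<^sub>0 \<noteq> {}" "compact K\<^sub>0" "K\<^sub>0 \<subseteq> cball 0 \<rho>"
    for K K\<^sub>0 :: "'a set"
  proof (rule le_sqrt_hausdorff_dist)
    show cl: "closed K" "closed K\<^sub>0" using K K0 by (auto intro: compact_imp_closed)
    fix \<epsilon> assume \<epsilon>: "0 < \<epsilon>" "\<epsilon> \<le> 2 * \<rho>" and sub: "K \<subseteq> parallel_set K\<^sub>0 \<epsilon>" "K\<^sub>0 \<subseteq> parallel_set K \<epsilon>"
    have \<epsilon>H: "sqrt \<epsilon> \<le> H" using \<epsilon> by (simp add: H_def)
    \<comment> \<open>The shell volume is linear in \<epsilon>; one of the two square roots is
      bounded by \<open>H\<close> to reach the order \<open>sqrt \<epsilon>\<close>.\<close>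
    have "\<epsilon> = sqrt \<epsilon> * sqrt \<epsilon>" using \<epsilon> by simp
    also have "\<dots> \<le> H * sqrt \<epsilon>" using \<epsilon> \<epsilon>H by (intro mult_right_mono) auto
    finally have \<epsilon>le: "c * \<epsilon> \<le> c * H * sqrt \<epsilon>" using c by (simp add: mult.assoc mult_left_mono)
    have shell': "measure lebesgue (parallel_set L R - parallel_set M R) \<le> c * H * sqrt \<epsilon>"
      if L: "closed L" "L \<noteq> {}" "L \<subseteq> cball 0 \<rho>" "L \<subseteq> parallel_set M \<epsilon>" for L M :: "'a set"
    proof -
      have "measure lebesgue (parallel_set L R - parallel_set M R) \<le>
          measure lebesgue (parallel_set L R - parallel_set L (R - \<epsilon>))"
        using parallel_set_diff_subset_shell[OF L(1,2,4)] parallel_set_lmeasurable[OF L(1-3)]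
          closed_parallel_set[of M]
        by (intro measure_mono_fmeasurable fmeasurable.Diff) (auto simp: borel_closed)
      also have "\<dots> \<le> c * \<epsilon>" using L \<epsilon> by (intro shell) auto
      finally show ?thesis using \<epsilon>le by simp
    qed
    show "bL_dist (r + s) (voronoi_tensor_measure R r s K) (voronoi_tensor_measure R r s K\<^sub>0) \<le> C * sqrt \<epsilon>"
    proof (rule bL_dist_le)
      fix f :: "'a \<Rightarrow> real" and v :: "nat \<Rightarrow> 'a"
      assume f: "f \<in> borel_measurable borel" "bounded (range f)" "\<And>x. \<bar>f x\<bar> \<le> 1"
        "\<And>x y. \<bar>f x - f y\<bar> \<le> norm (x - y)" and v: "\<forall>i<r + s. norm (v i) = 1"
      have "\<bar>tensor_integral (voronoi_tensor_measure R r s K) f v -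
          tensor_integral (voronoi_tensor_measure R r s K\<^sub>0) f v\<bar> \<le>
        B ^ (r + s) * ((1 + real (r + s)) *
            (LINT x:cball 0 (\<rho> + R)|lebesgue. norm (closest_point K x - closest_point K\<^sub>0 x)) +
          measure lebesgue (parallel_set K R - parallel_set K\<^sub>0 R) +
          measure lebesgue (parallel_set K\<^sub>0 R - parallel_set K R))"
        using assms pos by (intro tensor_integral_voronoi_diff_le K K0 v f) auto
      also have "\<dots> \<le> B ^ (r + s) * ((1 + real (r + s)) * (A * sqrt \<epsilon>) + c * H * sqrt \<epsilon> + c * H * sqrt \<epsilon>)"
      proof (intro mult_left_mono add_mono)
        show "(LINT x:cball 0 (\<rho> + R)|lebesgue. norm (closest_point K x - closest_point K\<^sub>0 x)) \<le> A * sqrt \<epsilon>"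
          unfolding A_def using assms \<epsilon>
          by (intro integral_closest_point_diff_le cl K K0 sub \<epsilon>H) auto
      qed (use pos shell' cl K K0 sub in auto)
      also have "\<dots> = (C - 1) * sqrt \<epsilon>"
        by (simp add: C_def algebra_simps)
      also have "\<dots> \<le> C * sqrt \<epsilon>"
        using \<epsilon> by (intro mult_right_mono) auto
      finally show "\<bar>tensor_integral (voronoi_tensor_measure R r s K) f v -
          tensor_integral (voronoi_tensor_measure R r s K\<^sub>0) f v\<bar> \<le> C * sqrt \<epsilon>" .
    qed
  qed (use K K0 assms C in auto)
  then show ?thesis using C by blast
qed

end
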